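(* Let $k=(k_1,\dots,k_l)\in\mathbb{Z}_+^l$ be a partition of $n$ and let $h\in\mathbb{Z}_+^l$ satisfy $1\le h_j\le k_j-1$ for all $j=1,\dots,l$. Let $\mathcal{T}_k$ be the subgroup of $\mathcal{T}$ consisting of those $M\in\mathcal{T}$ such that $\varphi(M[w])=\varphi([w])$ for every $\varphi\in\mathcal{A}_{k,h}$ and every $[w]\in\mathbb{P}^n(\mathbb{C})$ (at which $\varphi$ is defined). Then $\mathcal{T}_k$ is a closed subgroup of $\mathcal{T}$ isomorphic to $\mathbb{T}^l$. Furthermore, $M\in\mathcal{T}_k$ if and only if $$M=\left[\begin{pmatrix}\overline{t}_1^{k_1}\cdots\overline{t}_l^{k_l}&0&\cdots&0\\0&t_1I_{k_1}&\cdots&0\\\vdots&\vdots&\ddots&\vdots\\0&0&\cdots&t_lI_{k_l}\end{pmatrix}\right]$$ for some $t_1,\dots,t_l\in\mathbb{T}$.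
   Context: $\mathbb{Z}_+$ is the set of non-negative integers and $\mathbb{T}$ is the unit circle in $\mathbb{C}$. A partition of $n$ is $k=(k_1,\dots,k_l)$ with positive integer entries, $k_1\le\dots\le k_l$ and $k_1+\dots+k_l=n$. $\mathrm{PSU}(n+1)=\mathrm{SU}(n+1)/(\mathbb{T}I_{n+1}\cap\mathrm{SU}(n+1))$, $[A]$ denotes the class of $A$, and $[A]$ acts on $\mathbb{P}^n(\mathbb{C})$ by $[A][w]=[Aw]$. $\mathcal{T}=\{[D]\in\mathrm{PSU}(n+1): D\in\mathrm{SU}(n+1)\text{ diagonal}\}$. Vectors $w\in\mathbb{C}^{n+1}=\mathbb{C}\times\mathbb{C}^{k_1}\times\dots\times\mathbb{C}^{k_l}$ are written $w=(w_0,w_1,\dots,w_n)=(w_{(0)},w_{(1)},\dots,w_{(l)})$ with $w_{(0)}=w_0\in\mathbb{C}$ and $w_{(j)}\in\mathbb{C}^{k_j}$ (consecutive blocks); multi-indices $p\in\mathbb{Z}_+^{n+1}$ are decomposed in the same way, and $(p_{(j)})_r$ is the $r$-th entry of $p_{(j)}$. $|p|$ is the sum of the entries of a multi-index, and $v^{p}=\prod_i v_i^{p_i}$. $\mathcal{A}_{k,h}$ is the set of functions $\varphi$ on $\mathbb{P}^n(\mathbb{C})$ of the form $$\varphi([w])=a(|w_{(0)}|,|w_{(1)}|,\dots,|w_{(l)}|)\prod_{j=0}^l\left(\frac{w_{(j)}}{|w_{(j)}|}\right)^{p_{(j)}}\left(\frac{\overline{w}_{(j)}}{|w_{(j)}|}\right)^{q_{(j)}},$$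 where $a$ is a complex-valued function homogeneous of degree $0$ and $p,q\in\mathbb{Z}_+^{n+1}$ satisfy: $p\cdot q=\sum_i p_iq_i=0$; $|p_{(j)}|=|q_{(j)}|$ for all $j=0,\dots,l$ (so $p_0=q_0=0$); and for each $j=1,\dots,l$, $(p_{(j)})_r=0$ for $h_j<r\le k_j$ and $(q_{(j)})_s=0$ for $1\le s\le h_j$. Such a $\varphi$ is regarded as defined at the points $[w]$ with $w_{(j)}\neq0$ for every $j$ for which $p_{(j)}\ne0$ or $q_{(j)}\neq0$. *)

theory Defs
  imports
    "HOL-Analysis.Function_Topology"
    "HOL-Analysis.Elementary_Metric_Spaces"
    "HOL-Analysis.L2_Norm"
    "HOL-Algebra.Product_Groups"
    "Jordan_Normal_Form.Schur_Decomposition"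
begin

section \<open>The topological groups $T^l$, SU(N) and PSU(N)\<close>

definition circle_group :: "complex monoid" where
  "circle_group = \<lparr>carrier = sphere 0 1, monoid.mult = (*), one = 1\<rparr>"

definition torus_group :: "nat \<Rightarrow> (nat \<Rightarrow> complex) monoid" where
  "torus_group l = product_group {1..l} (\<lambda>_. circle_group)"

definition torus_topology :: "nat \<Rightarrow> (nat \<Rightarrow> complex) topology" where
  "torus_topology l = product_topology (\<lambda>_. top_of_set (sphere 0 1)) {1..l}"

definition SU :: "nat \<Rightarrow> complex mat monoid" where
  "SU N = \<lparr>carrier = {A \<in> carrier_mat N N. mat_adjoint A * A = 1\<^sub>m N \<and> Determinant.det A = 1},
           monoid.mult = (*), one = 1\<^sub>m N\<rparr>"

definition SU_topology :: "nat \<Rightarrow> complex mat topology" where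
  "SU_topology N = pullback_topology (carrier (SU N))
     (\<lambda>A. \<lambda>ij \<in> {..<N} \<times> {..<N}. A $$ ij)
     (product_topology (\<lambda>_. euclidean) ({..<N} \<times> {..<N}))"

definition SU_scalars :: "nat \<Rightarrow> complex mat set" where
  "SU_scalars N = {c \<cdot>\<^sub>m 1\<^sub>m N |c. c \<in> sphere 0 1} \<inter> carrier (SU N)"

definition PSU :: "nat \<Rightarrow> complex mat set monoid" where
  "PSU N = SU N Mod SU_scalars N"

definition PSU_class :: "nat \<Rightarrow> complex mat \<Rightarrow> complex mat set" where
  "PSU_class N A = SU_scalars N #>\<^bsub>SU N\<^esub> A"

text \<open>The quotient topology; see \<open>quotient_map_PSU_class\<close> below.\<close>

definition PSU_topology :: "nat \<Rightarrow> complex mat set topology" where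
  "PSU_topology N = topology (\<lambda>U. U \<subseteq> carrier (PSU N) \<and>
     openin (SU_topology N) {A \<in> carrier (SU N). PSU_class N A \<in> U})"

definition diag_torus :: "nat \<Rightarrow> complex mat set set" where
  "diag_torus N = {PSU_class N D |D. D \<in> carrier (SU N) \<and> diagonal_mat D}"


section \<open>Complex projective space and the action of PSU(n+1)\<close>

definition proj_point :: "complex vec \<Rightarrow> complex vec set" where
  "proj_point w = {c \<cdot>\<^sub>v w |c. c \<noteq> 0}"

text \<open>
  Pointwise product of a class of matrices and a line; it agrees with \<open>[A][w] = [A w]\<close>,
  see \<open>PSU_act_class\<close> below.
\<close>

definition PSU_act :: "complex mat set \<Rightarrow> complex vec set \<Rightarrow> complex vec set" where
  "PSU_act M L = {A *\<^sub>v w |A w. A \<in> M \<and> w \<in> L}"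


section \<open>Partitions and blocks of coordinates\<close>

definition is_partition :: "nat \<Rightarrow> nat \<Rightarrow> (nat \<Rightarrow> nat) \<Rightarrow> bool" where
  "is_partition n l k \<longleftrightarrow> (\<forall>j\<in>{1..l}. 0 < k j) \<and> mono_on {1..l} k \<and> (\<Sum>j=1..l. k j) = n"

text \<open>
  For \<open>1 \<le> j \<le> l\<close> and \<open>1 \<le> r \<le> k j\<close>, \<open>idx k j r\<close> is the position in \<open>{0..n}\<close> of the
  \<open>r\<close>-th entry of the \<open>j\<close>-th block.
\<close>

definition idx :: "(nat \<Rightarrow> nat) \<Rightarrow> nat \<Rightarrow> nat \<Rightarrow> nat" where
  "idx k j r = (\<Sum>i=1..<j. k i) + r"

definition block :: "(nat \<Rightarrow> nat) \<Rightarrow> nat \<Rightarrow> nat set" where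
  "block k j = (if j = 0 then {0} else idx k j ` {1..k j})"

definition block_norm :: "(nat \<Rightarrow> nat) \<Rightarrow> complex vec \<Rightarrow> nat \<Rightarrow> real" where
  "block_norm k w j = L2_set (\<lambda>i. cmod (w $ i)) (block k j)"


section \<open>The class of functions $A_{k,h}$\<close>

definition homogeneous_deg0 :: "nat \<Rightarrow> (real vec \<Rightarrow> complex) \<Rightarrow> bool" where
  "homogeneous_deg0 m a \<longleftrightarrow>
     (\<forall>x \<in> carrier_vec m. x \<noteq> 0\<^sub>v m \<and> (\<forall>j<m. 0 \<le> x $ j) \<longrightarrow> (\<forall>c>0. a (c \<cdot>\<^sub>v x) = a x))"

text \<open>Multi-indices are functions of which only the values on \<open>{0..n}\<close> matter.\<close>

definition admissible_indices ::
    "nat \<Rightarrow> nat \<Rightarrow> (nat \<Rightarrow> nat) \<Rightarrow> (nat \<Rightarrow> nat) \<Rightarrow> (nat \<Rightarrow> nat) \<Rightarrow> (nat \<Rightarrow> nat) \<Rightarrow> bool" where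
  "admissible_indices n l k h p q \<longleftrightarrow>
     (\<Sum>i=0..n. p i * q i) = 0 \<and>
     (\<forall>j\<in>{0..l}. (\<Sum>i\<in>block k j. p i) = (\<Sum>i\<in>block k j. q i)) \<and>
     (\<forall>j\<in>{1..l}. (\<forall>r. h j < r \<and> r \<le> k j \<longrightarrow> p (idx k j r) = 0) \<and>
                  (\<forall>s. 1 \<le> s \<and> s \<le> h j \<longrightarrow> q (idx k j s) = 0))"

text \<open>
  Where \<open>block_norm k w j = 0\<close>, the conventions \<open>x / 0 = 0\<close> and \<open>0 ^ 0 = 1\<close> make the \<open>j\<close>-th
  factor \<open>1\<close> if \<open>p\<close> and \<open>q\<close> vanish on the block; other such \<open>w\<close> are excluded by \<open>formula_dom\<close>.
\<close>

definition formula_value ::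
    "nat \<Rightarrow> (nat \<Rightarrow> nat) \<Rightarrow> (real vec \<Rightarrow> complex) \<Rightarrow> (nat \<Rightarrow> nat) \<Rightarrow> (nat \<Rightarrow> nat) \<Rightarrow>
     complex vec \<Rightarrow> complex" where
  "formula_value l k a p q w =
     a (vec (l + 1) (block_norm k w)) *
     (\<Prod>j=0..l. (\<Prod>i\<in>block k j. (w $ i / of_real (block_norm k w j)) ^ p i) *
                (\<Prod>i\<in>block k j. (cnj (w $ i) / of_real (block_norm k w j)) ^ q i))"

definition formula_dom ::
    "nat \<Rightarrow> nat \<Rightarrow> (nat \<Rightarrow> nat) \<Rightarrow> (nat \<Rightarrow> nat) \<Rightarrow> (nat \<Rightarrow> nat) \<Rightarrow> complex vec set" where
  "formula_dom n l k p q = {w \<in> carrier_vec (n + 1). w \<noteq> 0\<^sub>v (n + 1) \<and>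
     (\<forall>j\<in>{0..l}. (\<exists>i\<in>block k j. p i \<noteq> 0 \<or> q i \<noteq> 0) \<longrightarrow> (\<exists>i\<in>block k j. w $ i \<noteq> 0))}"

text \<open>
  The elements are partial functions on projective space. The value is prescribed at every
  representative of a point; it does not depend on the representative, since \<open>a\<close> is
  homogeneous of degree \<open>0\<close> and \<open>p\<close>, \<open>q\<close> have equal block sums.
\<close>

definition A_kh :: "nat \<Rightarrow> nat \<Rightarrow> (nat \<Rightarrow> nat) \<Rightarrow> (nat \<Rightarrow> nat) \<Rightarrow>
    (complex vec set \<Rightarrow> complex option) set" where
  "A_kh n l k h = {\<phi>. \<exists>a p q. homogeneous_deg0 (l + 1) a \<and> admissible_indices n l k h p q \<and>
     dom \<phi> = proj_point ` formula_dom n l k p q \<and>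
     (\<forall>w \<in> formula_dom n l k p q. \<phi> (proj_point w) = Some (formula_value l k a p q w))}"

definition T_k :: "nat \<Rightarrow> nat \<Rightarrow> (nat \<Rightarrow> nat) \<Rightarrow> (nat \<Rightarrow> nat) \<Rightarrow> complex mat set set" where
  "T_k n l k h = {M \<in> diag_torus (n + 1).
     \<forall>\<phi> \<in> A_kh n l k h. \<forall>L \<in> dom \<phi>. \<phi> (PSU_act M L) = \<phi> L}"

definition block_scalar_mat :: "nat \<Rightarrow> (nat \<Rightarrow> nat) \<Rightarrow> (nat \<Rightarrow> complex) \<Rightarrow> complex mat" where
  "block_scalar_mat l k t = diag_block_mat
     ((\<Prod>j=1..l. cnj (t j) ^ k j) \<cdot>\<^sub>m 1\<^sub>m 1 # map (\<lambda>j. t j \<cdot>\<^sub>m 1\<^sub>m (k j)) [1..<l + 1])"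


section \<open>Consistency of the definitions\<close>

lemma topspace_SU_topology [simp]: "topspace (SU_topology N) = carrier (SU N)"
  by (auto simp: SU_topology_def topspace_pullback_topology)

lemma carrier_PSU: "carrier (PSU N) = PSU_class N ` carrier (SU N)"
  by (auto simp: PSU_def FactGroup_def RCOSETS_def PSU_class_def)

lemma openin_PSU_topology:
  "openin (PSU_topology N) U \<longleftrightarrow> U \<subseteq> carrier (PSU N) \<and>
     openin (SU_topology N) {A \<in> carrier (SU N). PSU_class N A \<in> U}"
proof -
  have "istopology (\<lambda>U. U \<subseteq> carrier (PSU N) \<and>
     openin (SU_topology N) {A \<in> carrier (SU N). PSU_class N A \<in> U})"
    unfolding istopology_def
  proof (rule conjI; intro allI impI)
    fix S T
    assume S: "S \<subseteq> carrier (PSU N) \<and> openin (SU_topology N) {A \<in> carrier (SU N). PSU_class N A \<in> S}"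
      and T: "T \<subseteq> carrier (PSU N) \<and> openin (SU_topology N) {A \<in> carrier (SU N). PSU_class N A \<in> T}"
    have "{A \<in> carrier (SU N). PSU_class N A \<in> S \<inter> T} =
      {A \<in> carrier (SU N). PSU_class N A \<in> S} \<inter> {A \<in> carrier (SU N). PSU_class N A \<in> T}" by auto
    then show "S \<inter> T \<subseteq> carrier (PSU N) \<and>
       openin (SU_topology N) {A \<in> carrier (SU N). PSU_class N A \<in> S \<inter> T}"
      using S T by (auto intro: openin_Int)
  next
    fix K
    assume K: "\<forall>S\<in>K. S \<subseteq> carrier (PSU N) \<and>
      openin (SU_topology N) {A \<in> carrier (SU N). PSU_class N A \<in> S}"
    have "{A \<in> carrier (SU N). PSU_class N A \<in> \<Union>K} =
      (\<Union>S\<in>K. {A \<in> carrier (SU N). PSU_class N A \<in> S})" by auto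
    then show "\<Union>K \<subseteq> carrier (PSU N) \<and>
       openin (SU_topology N) {A \<in> carrier (SU N). PSU_class N A \<in> \<Union>K}"
      using K by (auto intro!: openin_Union)
  qed
  then show ?thesis
    by (simp add: PSU_topology_def)
qed

lemma topspace_PSU_topology [simp]: "topspace (PSU_topology N) = carrier (PSU N)"
proof (rule antisym)
  show "topspace (PSU_topology N) \<subseteq> carrier (PSU N)"
    using openin_PSU_topology[of N "topspace (PSU_topology N)"] by simp
  have "{A \<in> carrier (SU N). PSU_class N A \<in> carrier (PSU N)} = topspace (SU_topology N)"
    by (auto simp: carrier_PSU)
  then have "openin (PSU_topology N) (carrier (PSU N))"
    unfolding openin_PSU_topology by (metis openin_topspace subset_refl)
  then show "carrier (PSU N) \<subseteq> topspace (PSU_topology N)"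
    by (rule openin_subset)
qed

lemma quotient_map_PSU_class: "quotient_map (SU_topology N) (PSU_topology N) (PSU_class N)"
  unfolding quotient_map_def by (auto simp: openin_PSU_topology carrier_PSU)

lemma mat_adjoint_index:
  fixes A :: "complex mat"
  assumes "i < dim_col A" "j < dim_row A"
  shows "mat_adjoint A $$ (i, j) = cnj (A $$ (j, i))"
  using assms by (simp add: mat_adjoint_def mat_of_rows_index)

lemma mat_adjoint_one: "mat_adjoint (1\<^sub>m N :: complex mat) = 1\<^sub>m N"
proof (rule eq_matI)
  fix i j assume "i < dim_row (1\<^sub>m N :: complex mat)" "j < dim_col (1\<^sub>m N :: complex mat)"
  then show "mat_adjoint (1\<^sub>m N :: complex mat) $$ (i, j) = 1\<^sub>m N $$ (i, j)"
    by (subst mat_adjoint_index) auto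
qed (simp_all add: mat_adjoint_def)

lemma PSU_act_class:
  assumes A: "A \<in> carrier (SU N)" and w: "w \<in> carrier_vec N"
  shows "PSU_act (PSU_class N A) (proj_point w) = proj_point (A *\<^sub>v w)"
proof -
  have AN: "A \<in> carrier_mat N N" using A by (simp add: SU_def)
  have prod: "(c \<cdot>\<^sub>m 1\<^sub>m N * A) *\<^sub>v (d \<cdot>\<^sub>v w) = (c * d) \<cdot>\<^sub>v (A *\<^sub>v w)" for c d
  proof -
    have "c \<cdot>\<^sub>m 1\<^sub>m N * A = c \<cdot>\<^sub>m A"
      using AN mult_smult_assoc_mat[of "1\<^sub>m N" N N A N c] by simp
    then show ?thesis
      using AN w by (auto simp: mult_mat_vec smult_smult_assoc)
  qed
  have one: "1\<^sub>m N \<in> SU_scalars N"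
    by (auto simp: SU_scalars_def SU_def mat_adjoint_one intro!: exI[of _ 1])
  show ?thesis
  proof (intro equalityI subsetI)
    fix v assume "v \<in> PSU_act (PSU_class N A) (proj_point w)"
    then obtain Z d where Z: "Z \<in> SU_scalars N" "d \<noteq> 0" "v = (Z * A) *\<^sub>v (d \<cdot>\<^sub>v w)"
      by (auto simp: PSU_act_def PSU_class_def r_coset_def proj_point_def SU_def)
    then obtain c where "Z = c \<cdot>\<^sub>m 1\<^sub>m N" "c \<in> sphere 0 1"
      unfolding SU_scalars_def by blast
    moreover from this have "c \<noteq> 0" by auto
    ultimately have "v = (c * d) \<cdot>\<^sub>v (A *\<^sub>v w)" "c * d \<noteq> 0" using Z prod by auto
    then show "v \<in> proj_point (A *\<^sub>v w)" unfolding proj_point_def by blast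
  next
    fix v assume "v \<in> proj_point (A *\<^sub>v w)"
    then obtain d where d: "d \<noteq> 0" "v = d \<cdot>\<^sub>v (A *\<^sub>v w)" by (auto simp: proj_point_def)
    have "v = (1\<^sub>m N * A) *\<^sub>v (d \<cdot>\<^sub>v w)" using d AN w by (simp add: mult_mat_vec)
    then show "v \<in> PSU_act (PSU_class N A) (proj_point w)"
      using d one
      unfolding PSU_act_def PSU_class_def r_coset_def proj_point_def SU_def by auto
  qed
qed

end

theory Submission
  imports Defs "HOL-Analysis.T1_Spaces"
begin

text \<open>
  Represent an element of \<open>\<T>\<close> by a diagonal matrix with unimodular entries \<open>f 0, \<dots>, f n\<close> of
  product \<open>1\<close>. On a point \<open>[w]\<close> it multiplies \<open>w\<^sub>i\<close> by \<open>f i\<close>, so the whole theorem rests on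
  one observation: the functions in the class can tell two entries of \<open>f\<close> apart exactly if they
  lie in the same block.

  If \<open>f\<close> is constant on every block, each block \<open>w\<^sub>(\<^sub>j\<^sub>)\<close> is multiplied by one unimodular number. The
  block norms do not change, and the equality of the degrees of \<open>p\<close> and \<open>q\<close> on each block cancels the
  multipliers (\<open>formula_value_block_scale\<close>; the same computation, with one nonzero multiplier for
  all blocks, shows that the formula depends only on the point \<open>[w]\<close>). Conversely, for
  \<open>r \<le> h\<^sub>j < s\<close> the function \<open>(w\<^sub>(\<^sub>j\<^sub>))\<^sub>r cnj ((w\<^sub>(\<^sub>j\<^sub>))\<^sub>s) / |w\<^sub>(\<^sub>j\<^sub>)|\<^sup>2\<close> belongs to the class, and its value at
  \<open>[1 : \<dots> : 1]\<close> is preserved only if the corresponding entries of \<open>f\<close> agree. As \<open>1 \<le> h\<^sub>j < k\<^sub>j\<close>,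
  both ranges of indices are nonempty, and the complete bipartite graph between them is connected,
  so \<open>f\<close> is constant on the block (\<open>T_k_mat_diag_iff\<close>). The determinant then forces the entry
  \<open>f 0\<close>, which gives the matrix description (\<open>T_k_iff_block_scalar\<close>).

  The parameters \<open>t\<^sub>1, \<dots>, t\<^sub>l\<close> of that description are not coordinates on the group: they are
  determined only up to a common \<open>(n+1)\<close>-st root of unity. Invariant under scalars are the
  ratios \<open>t\<^sub>j / t\<^sub>0\<close>, where \<open>t\<^sub>0\<close> is the top left entry. They are continuous and multiplicative,
  they determine the class, and every \<open>s\<close> in the torus is attained, because the determinant condition
  becomes the equation \<open>t\<^sub>0\<^bsup>n+1\<^esup> = \<Prod>\<^sub>j s\<^sub>j\<^bsup>-k\<^sub>j\<^esup>\<close>, which has a unimodular solution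
  (\<open>bij_betw_ratio_map\<close>).

  The topological claims are formal consequences. The group is a continuous image of the compact torus
  (\<open>compactin_T_k\<close>), so it is closed in the Hausdorff space \<open>\<T>\<close>, and the continuous bijection
  given by the ratios, from a compact to a Hausdorff space, is a homeomorphism.
\<close>

section \<open>The groups SU(N) and PSU(N)\<close>

lemma mat_adjoint_carrier:
  fixes A :: "complex mat"
  assumes "A \<in> carrier_mat n m"
  shows "mat_adjoint A \<in> carrier_mat m n"
  using assms by (intro carrier_matI) (auto simp: mat_adjoint_def)

lemma mat_adjoint_mult:
  fixes A B :: "complex mat"
  assumes A: "A \<in> carrier_mat n n" and B: "B \<in> carrier_mat n n"
  shows "mat_adjoint (A * B) = mat_adjoint B * mat_adjoint A"
proof (rule eq_matI)
  have dims: "mat_adjoint A \<in> carrier_mat n n" "mat_adjoint B \<in> carrier_mat n n"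
    using A B by (auto intro: mat_adjoint_carrier)
  show "dim_row (mat_adjoint (A * B)) = dim_row (mat_adjoint B * mat_adjoint A)"
    "dim_col (mat_adjoint (A * B)) = dim_col (mat_adjoint B * mat_adjoint A)"
    using A B dims mat_adjoint_carrier[of "A * B" n n] by auto
  fix i j assume "i < dim_row (mat_adjoint B * mat_adjoint A)"
    "j < dim_col (mat_adjoint B * mat_adjoint A)"
  then have ij: "i < n" "j < n" using dims by auto
  have "mat_adjoint (A * B) $$ (i, j) = cnj ((A * B) $$ (j, i))"
    using A B ij by (subst mat_adjoint_index) auto
  also have "\<dots> = (\<Sum>m = 0..<n. cnj (A $$ (j, m)) * cnj (B $$ (m, i)))"
    using A B ij by (simp add: scalar_prod_def)
  also have "\<dots> = (\<Sum>m = 0..<n. mat_adjoint B $$ (i, m) * mat_adjoint A $$ (m, j))"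
    using A B ij by (intro sum.cong) (auto simp: mat_adjoint_index)
  also have "\<dots> = (mat_adjoint B * mat_adjoint A) $$ (i, j)"
    using dims ij by (simp add: scalar_prod_def)
  finally show "mat_adjoint (A * B) $$ (i, j) = (mat_adjoint B * mat_adjoint A) $$ (i, j)" .
qed

lemma mat_adjoint_mat_adjoint:
  fixes A :: "complex mat"
  assumes A: "A \<in> carrier_mat n n"
  shows "mat_adjoint (mat_adjoint A) = A"
proof -
  have B: "mat_adjoint A \<in> carrier_mat n n" using A by (rule mat_adjoint_carrier)
  show ?thesis
    using A B mat_adjoint_carrier[OF B] by (intro eq_matI) (auto simp: mat_adjoint_index)
qed

lemma group_SU: "group (SU N)"
proof (rule groupI)
  fix A B assume "A \<in> carrier (SU N)" "B \<in> carrier (SU N)"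
  then have A: "A \<in> carrier_mat N N" "mat_adjoint A * A = 1\<^sub>m N" "Determinant.det A = 1"
    and B: "B \<in> carrier_mat N N" "mat_adjoint B * B = 1\<^sub>m N" "Determinant.det B = 1"
    by (auto simp: SU_def)
  have adj: "mat_adjoint A \<in> carrier_mat N N" "mat_adjoint B \<in> carrier_mat N N"
    using A B by (auto intro: mat_adjoint_carrier)
  have "mat_adjoint (A * B) * (A * B) = mat_adjoint B * ((mat_adjoint A * A) * B)"
    using A(1) B(1) adj by (simp add: mat_adjoint_mult assoc_mult_mat[of _ N N _ N _ N])
  then show "A \<otimes>\<^bsub>SU N\<^esub> B \<in> carrier (SU N)"
    using A B by (simp add: SU_def det_mult)
next
  show "\<one>\<^bsub>SU N\<^esub> \<in> carrier (SU N)" by (simp add: SU_def mat_adjoint_one)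
next
  fix A B C assume "A \<in> carrier (SU N)" "B \<in> carrier (SU N)" "C \<in> carrier (SU N)"
  then show "A \<otimes>\<^bsub>SU N\<^esub> B \<otimes>\<^bsub>SU N\<^esub> C = A \<otimes>\<^bsub>SU N\<^esub> (B \<otimes>\<^bsub>SU N\<^esub> C)"
    by (auto simp: SU_def assoc_mult_mat[of _ N N _ N _ N])
next
  fix A assume "A \<in> carrier (SU N)"
  then show "\<one>\<^bsub>SU N\<^esub> \<otimes>\<^bsub>SU N\<^esub> A = A" by (auto simp: SU_def)
next
  fix A assume "A \<in> carrier (SU N)"
  then have A: "A \<in> carrier_mat N N" "mat_adjoint A * A = 1\<^sub>m N" "Determinant.det A = 1"
    by (auto simp: SU_def)
  have adj: "mat_adjoint A \<in> carrier_mat N N"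
    using A by (auto intro: mat_adjoint_carrier)
  have "Determinant.det (mat_adjoint A * A) = 1" using A by simp
  then have "Determinant.det (mat_adjoint A) = 1" using A(1,3) adj by (simp add: det_mult)
  moreover have "A * mat_adjoint A = 1\<^sub>m N"
    using mat_mult_left_right_inverse[OF adj A(1)] A(2) by simp
  ultimately have "mat_adjoint A \<in> carrier (SU N)"
    using A adj by (simp add: SU_def mat_adjoint_mat_adjoint)
  then show "\<exists>B\<in>carrier (SU N). B \<otimes>\<^bsub>SU N\<^esub> A = \<one>\<^bsub>SU N\<^esub>"
    using A by (auto simp: SU_def intro!: bexI[of _ "mat_adjoint A"])
qed

lemma unimodular_iff_mult_cnj: "cmod z = 1 \<longleftrightarrow> cnj z * z = 1"
proof -
  have "cnj z * z = complex_of_real ((cmod z)\<^sup>2)" by (simp only: complex_norm_square mult.commute)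
  then have "cnj z * z = 1 \<longleftrightarrow> (cmod z)\<^sup>2 = 1" by (simp only: of_real_eq_1_iff)
  then show ?thesis by (simp add: abs_square_eq_1)
qed

lemma mat_diag_index [simp]:
  "i < n \<Longrightarrow> j < n \<Longrightarrow> mat_diag n f $$ (i, j) = (if i = j then f j else 0)"
  by (simp add: mat_diag_def)

lemma mat_diag_dims [simp]: "dim_row (mat_diag n f) = n" "dim_col (mat_diag n f) = n"
  by (simp_all add: mat_diag_def)

lemma mat_diag_eq_iff: "mat_diag n f = mat_diag n g \<longleftrightarrow> (\<forall>i<n. f i = g i)"
proof
  assume eq: "mat_diag n f = mat_diag n g"
  show "\<forall>i<n. f i = g i"
  proof (intro allI impI)
    fix i assume "i < n"
    then show "f i = g i" using arg_cong[OF eq, of "\<lambda>A. A $$ (i, i)"] by simp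
  qed
qed (auto intro!: eq_matI)

lemma smult_one_mat_eq_mat_diag: "c \<cdot>\<^sub>m 1\<^sub>m n = mat_diag n (\<lambda>_. c :: complex)"
  by (intro eq_matI) auto

lemma diagonal_mat_eq_mat_diag:
  assumes "A \<in> carrier_mat n n" "diagonal_mat A"
  shows "A = mat_diag n (\<lambda>i. A $$ (i, i))"
  using assms by (intro eq_matI) (auto simp: diagonal_mat_def)

lemma mat_diag_mult_vec:
  fixes f :: "nat \<Rightarrow> 'a :: semiring_1"
  assumes "w \<in> carrier_vec n"
  shows "mat_diag n f *\<^sub>v w = vec n (\<lambda>i. f i * w $ i)"
proof (rule eq_vecI)
  fix i assume "i < dim_vec (vec n (\<lambda>i. f i * w $ i))"
  then have i: "i < n" by simp
  have "(mat_diag n f *\<^sub>v w) $ i = (\<Sum>j = 0..<n. (if i = j then f j else 0) * w $ j)"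
    using i assms by (simp add: scalar_prod_def)
  also have "\<dots> = (\<Sum>j = 0..<n. if i = j then f j * w $ j else 0)"
    by (intro sum.cong) auto
  finally show "(mat_diag n f *\<^sub>v w) $ i = vec n (\<lambda>i. f i * w $ i) $ i" using i by simp
qed simp

lemma mat_diag_in_SU_iff:
  "mat_diag N f \<in> carrier (SU N) \<longleftrightarrow> (\<forall>i<N. cmod (f i) = 1) \<and> (\<Prod>i<N. f i) = 1"
proof -
  have "mat_adjoint (mat_diag N f) = mat_diag N (\<lambda>i. cnj (f i))"
    using mat_adjoint_carrier[of "mat_diag N f" N N]
    by (intro eq_matI) (auto simp: mat_adjoint_index)
  then have "mat_adjoint (mat_diag N f) * mat_diag N f = mat_diag N (\<lambda>i. cnj (f i) * f i)"
    by simp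
  moreover have "mat_diag N (\<lambda>i. cnj (f i) * f i) = 1\<^sub>m N \<longleftrightarrow> (\<forall>i<N. cmod (f i) = 1)"
    unfolding mat_diag_one[of N, symmetric] mat_diag_eq_iff by (simp add: unimodular_iff_mult_cnj)
  moreover have "Determinant.det (mat_diag N f) = (\<Prod>i<N. f i)"
  proof -
    have "Determinant.det (mat_diag N f) = prod_list (diag_mat (mat_diag N f))"
      by (rule det_upper_triangular[of _ N]) (auto simp: upper_triangular_def)
    then show ?thesis by (simp add: prod_list_diag_prod atLeast0LessThan)
  qed
  ultimately show ?thesis by (simp add: SU_def del: mat_diag_diag)
qed

lemma mult_SU: "x \<otimes>\<^bsub>SU N\<^esub> y = x * y" and one_SU: "\<one>\<^bsub>SU N\<^esub> = 1\<^sub>m N"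
  by (simp_all add: SU_def)

lemma mat_diag_mult_in_SU:
  assumes "mat_diag N f \<in> carrier (SU N)" "mat_diag N g \<in> carrier (SU N)"
  shows "mat_diag N (\<lambda>i. f i * g i) \<in> carrier (SU N)"
  using assms by (auto simp: mat_diag_in_SU_iff norm_mult prod.distrib)

lemma mat_diag_cnj_in_SU:
  assumes "mat_diag N f \<in> carrier (SU N)"
  shows "mat_diag N (\<lambda>i. cnj (f i)) \<in> carrier (SU N)"
  using assms by (auto simp: mat_diag_in_SU_iff simp flip: cnj_prod)

lemma inv_SU_mat_diag:
  assumes f: "mat_diag N f \<in> carrier (SU N)"
  shows "inv\<^bsub>SU N\<^esub> (mat_diag N f) = mat_diag N (\<lambda>i. cnj (f i))"
proof (rule group.inv_equality[OF group_SU])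
  have "mat_diag N (\<lambda>i. cnj (f i) * f i) = mat_diag N (\<lambda>_. 1)"
    using f unfolding mat_diag_eq_iff mat_diag_in_SU_iff by (simp add: unimodular_iff_mult_cnj)
  then show "mat_diag N (\<lambda>i. cnj (f i)) \<otimes>\<^bsub>SU N\<^esub> mat_diag N f = \<one>\<^bsub>SU N\<^esub>"
    by (simp add: mult_SU one_SU)
qed (use assms mat_diag_cnj_in_SU in auto)

lemma SU_scalars_iff:
  "Z \<in> SU_scalars N \<longleftrightarrow> (\<exists>c. cmod c = 1 \<and> Z = mat_diag N (\<lambda>_. c) \<and> Z \<in> carrier (SU N))"
  by (auto simp: SU_scalars_def smult_one_mat_eq_mat_diag)

text \<open>
  Scalar matrices are central, so conjugation fixes them.
\<close>

lemma normal_SU_scalars: "SU_scalars N \<lhd> SU N"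
proof -
  interpret group "SU N" by (rule group_SU)
  have sub: "subgroup (SU_scalars N) (SU N)"
  proof (rule subgroupI)
    show "SU_scalars N \<subseteq> carrier (SU N)" by (auto simp: SU_scalars_def)
    have "mat_diag N (\<lambda>_. 1) \<in> SU_scalars N"
      unfolding SU_scalars_iff mat_diag_in_SU_iff by (intro exI[of _ 1]) auto
    then show "SU_scalars N \<noteq> {}" by blast
  next
    fix a assume "a \<in> SU_scalars N"
    then obtain c where c: "cmod c = 1" "a = mat_diag N (\<lambda>_. c)"
      and a: "mat_diag N (\<lambda>_. c) \<in> carrier (SU N)"
      by (auto simp: SU_scalars_iff)
    show "inv\<^bsub>SU N\<^esub> a \<in> SU_scalars N"
      using c mat_diag_cnj_in_SU[OF a] inv_SU_mat_diag[OF a]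
      unfolding SU_scalars_iff by (intro exI[of _ "cnj c"]) auto
  next
    fix a b assume "a \<in> SU_scalars N" "b \<in> SU_scalars N"
    then obtain c d where c: "cmod c = 1" "a = mat_diag N (\<lambda>_. c)" "cmod d = 1" "b = mat_diag N (\<lambda>_. d)"
      and ab: "mat_diag N (\<lambda>_. c) \<in> carrier (SU N)" "mat_diag N (\<lambda>_. d) \<in> carrier (SU N)"
      by (auto simp: SU_scalars_iff)
    show "a \<otimes>\<^bsub>SU N\<^esub> b \<in> SU_scalars N"
      using c mat_diag_mult_in_SU[OF ab]
      unfolding SU_scalars_iff by (intro exI[of _ "c * d"]) (auto simp: mult_SU norm_mult)
  qed
  have "x \<otimes>\<^bsub>SU N\<^esub> z \<otimes>\<^bsub>SU N\<^esub> inv\<^bsub>SU N\<^esub> x \<in> SU_scalars N"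
    if x: "x \<in> carrier (SU N)" and z: "z \<in> SU_scalars N" for x z
  proof -
    obtain c where c: "z = mat_diag N (\<lambda>_. c)" using z by (auto simp: SU_scalars_iff)
    have xN: "x \<in> carrier_mat N N" using x by (simp add: SU_def)
    have "x * z = z * x"
      unfolding c mat_diag_mult_left[OF xN] mat_diag_mult_right[OF xN] by (auto simp: mult.commute)
    then have "x \<otimes>\<^bsub>SU N\<^esub> z \<otimes>\<^bsub>SU N\<^esub> inv\<^bsub>SU N\<^esub> x = z"
      using x z subgroup.mem_carrier[OF sub] by (metis inv_solve_right m_closed mult_SU)
    then show ?thesis using z by simp
  qed
  then show ?thesis using sub by (auto simp: normal_inv_iff)
qed

lemma group_hom_PSU_class: "group_hom (SU N) (PSU N) (PSU_class N)"
proof -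
  interpret normal "SU_scalars N" "SU N" by (rule normal_SU_scalars)
  have "(\<lambda>a. SU_scalars N #>\<^bsub>SU N\<^esub> a) \<in> hom (SU N) (SU N Mod SU_scalars N)"
    by (rule r_coset_hom_Mod)
  moreover have "(\<lambda>a. SU_scalars N #>\<^bsub>SU N\<^esub> a) = PSU_class N" by (simp add: fun_eq_iff PSU_class_def)
  ultimately show ?thesis
    unfolding group_hom_def group_hom_axioms_def PSU_def using factorgroup_is_group by simp
qed

lemma PSU_class_memD:
  assumes A: "A \<in> carrier (SU N)" and B: "B \<in> PSU_class N A"
  shows "\<exists>c. cmod c = 1 \<and> B = c \<cdot>\<^sub>m A"
proof -
  obtain Z where Z: "Z \<in> SU_scalars N" "B = Z * A"
    using B by (auto simp: PSU_class_def r_coset_def mult_SU)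
  then obtain c where c: "cmod c = 1" "Z = mat_diag N (\<lambda>_. c)" by (auto simp: SU_scalars_iff)
  have AN: "A \<in> carrier_mat N N" using A by (simp add: SU_def)
  have "B = c \<cdot>\<^sub>m A"
    unfolding Z(2) c mat_diag_mult_left[OF AN] using AN by (intro eq_matI) auto
  then show ?thesis using c by blast
qed

text \<open>
  For unitary diagonal matrices this is the quotient of the \<open>i\<close>-th entry by the \<open>0\<close>-th one. The product
  with the conjugate, unlike the quotient, is continuous on the whole group, also where the
  corner entry vanishes.
\<close>

definition diag_ratio :: "nat \<Rightarrow> complex mat set \<Rightarrow> complex" where
  "diag_ratio i M = (let A = (SOME A. A \<in> M) in A $$ (i, i) * cnj (A $$ (0, 0)))"

text \<open>
  The choice of a representative does not matter: two of them differ by a unimodular factor, which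
  meets its conjugate in the product.
\<close>

lemma diag_ratio_PSU_class:
  assumes A: "A \<in> carrier (SU N)" and i: "i < N"
  shows "diag_ratio i (PSU_class N A) = A $$ (i, i) * cnj (A $$ (0, 0))"
proof -
  interpret normal "SU_scalars N" "SU N" by (rule normal_SU_scalars)
  define B where "B = (SOME B. B \<in> PSU_class N A)"
  have "A \<in> PSU_class N A" unfolding PSU_class_def using A by (rule rcos_self)(rule is_subgroup)
  then have "B \<in> PSU_class N A" unfolding B_def by (rule someI)
  then obtain c where c: "cmod c = 1" "B = c \<cdot>\<^sub>m A" using PSU_class_memD[OF A] by blast
  have "A \<in> carrier_mat N N" using A by (simp add: SU_def)
  then have "B $$ (i, i) * cnj (B $$ (0, 0)) = (cnj c * c) * (A $$ (i, i) * cnj (A $$ (0, 0)))"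
    using c i by simp
  also have "cnj c * c = 1" using c by (simp add: unimodular_iff_mult_cnj)
  finally show ?thesis by (simp add: diag_ratio_def B_def Let_def)
qed

lemma diag_ratio_mat_diag:
  assumes "mat_diag N f \<in> carrier (SU N)" "i < N"
  shows "diag_ratio i (PSU_class N (mat_diag N f)) = f i * cnj (f 0)"
  using assms by (simp add: diag_ratio_PSU_class)

text \<open>
  The ratios are a complete invariant of a diagonal class: if they agree, the two matrices differ by the
  scalar \<open>g 0 * cnj (f 0)\<close>, which is unimodular and whose \<open>N\<close>-th power is \<open>1\<close> by comparison of
  the determinants.
\<close>

lemma PSU_class_mat_diag_eqI:
  assumes f: "mat_diag N f \<in> carrier (SU N)" and g: "mat_diag N g \<in> carrier (SU N)"
    and eq: "\<And>i. i < N \<Longrightarrow> f i * cnj (f 0) = g i * cnj (g 0)"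
  shows "PSU_class N (mat_diag N f) = PSU_class N (mat_diag N g)"
proof (cases "N = 0")
  case True
  then have "mat_diag N f = mat_diag N g" by (simp add: mat_diag_eq_iff)
  then show ?thesis by simp
next
  case False
  interpret normal "SU_scalars N" "SU N" by (rule normal_SU_scalars)
  define c where "c = g 0 * cnj (f 0)"
  have f0: "cmod (f 0) = 1" and g0: "cmod (g 0) = 1"
    using f g False by (auto simp: mat_diag_in_SU_iff)
  have gi: "g i = c * f i" if "i < N" for i
  proof -
    have "c * f i = g 0 * (f i * cnj (f 0))" by (simp add: c_def mult_ac)
    also have "\<dots> = (cnj (g 0) * g 0) * g i" using eq[OF that] by (simp add: mult_ac)
    also have "cnj (g 0) * g 0 = 1" using g0 by (simp add: unimodular_iff_mult_cnj)
    finally show ?thesis by simp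
  qed
  have "(\<Prod>i<N. g i) = (\<Prod>i<N. c * f i)" using gi by (intro prod.cong) auto
  then have "(\<Prod>i<N. c) = 1" using f g by (simp add: prod.distrib mat_diag_in_SU_iff)
  moreover have "cmod c = 1" using f0 g0 by (simp add: c_def norm_mult)
  ultimately have Z: "mat_diag N (\<lambda>_. c) \<in> SU_scalars N"
    by (auto simp: SU_scalars_iff mat_diag_in_SU_iff)
  have "mat_diag N g = mat_diag N (\<lambda>_. c) * mat_diag N f"
    using gi by (simp add: mat_diag_eq_iff)
  then have "mat_diag N g \<in> SU_scalars N #>\<^bsub>SU N\<^esub> mat_diag N f"
    using Z unfolding r_coset_def mult_SU by blast
  then show ?thesis
    unfolding PSU_class_def using f by (intro repr_independence) (auto intro: is_subgroup)
qed

lemma continuous_map_mult_complex: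
  fixes f g :: "'a \<Rightarrow> complex"
  assumes "continuous_map X euclidean f" "continuous_map X euclidean g"
  shows "continuous_map X euclidean (\<lambda>x. f x * g x)"
  using assms by (simp add: continuous_map_atin tendsto_mult)

lemma continuous_map_prod_complex:
  fixes f :: "'a \<Rightarrow> 'b \<Rightarrow> complex"
  assumes "\<And>i. i \<in> I \<Longrightarrow> continuous_map X euclidean (\<lambda>x. f x i)"
  shows "continuous_map X euclidean (\<lambda>x. \<Prod>i\<in>I. f x i)"
  using assms by (simp add: continuous_map_atin tendsto_prod)

text \<open>
  By the universal property of the quotient topology, continuity is checked on matrices, where the
  ratio is a polynomial in the entries and their conjugates.
\<close>

lemma continuous_map_diag_ratio:
  assumes i: "i < N"
  shows "continuous_map (PSU_topology N) euclidean (diag_ratio i)"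
proof (rule continuous_compose_quotient_map[OF quotient_map_PSU_class])
  have entry: "continuous_map (SU_topology N) euclidean (\<lambda>A. A $$ (i, i))" if "i < N" for i
  proof -
    have "continuous_map (product_topology (\<lambda>_. euclidean) ({..<N} \<times> {..<N})) euclidean
        (\<lambda>x :: nat \<times> nat \<Rightarrow> complex. x (i, i))"
      using that by (intro continuous_map_product_projection) auto
    from continuous_map_pullback[OF this, of "carrier (SU N)" "\<lambda>A. \<lambda>ij \<in> {..<N} \<times> {..<N}. A $$ ij"]
    show ?thesis using that by (simp add: SU_topology_def o_def)
  qed
  have "continuous_map euclidean euclidean cnj"
    by (simp add: continuous_intros)
  then have "continuous_map (SU_topology N) euclidean (cnj \<circ> (\<lambda>A. A $$ (0, 0)))"
    using i by (intro continuous_map_compose[OF entry]) auto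
  then have "continuous_map (SU_topology N) euclidean (\<lambda>A. A $$ (i, i) * cnj (A $$ (0, 0)))"
    by (intro continuous_map_mult_complex entry i) (simp add: o_def)
  then show "continuous_map (SU_topology N) euclidean (diag_ratio i \<circ> PSU_class N)"
    by (rule continuous_map_eq) (simp add: diag_ratio_PSU_class i)
qed

lemma diag_torus_iff:
  "M \<in> diag_torus N \<longleftrightarrow> (\<exists>f. mat_diag N f \<in> carrier (SU N) \<and> M = PSU_class N (mat_diag N f))"
proof
  assume "M \<in> diag_torus N"
  then obtain D where D: "D \<in> carrier (SU N)" "diagonal_mat D" "M = PSU_class N D"
    by (auto simp: diag_torus_def)
  then have "D = mat_diag N (\<lambda>i. D $$ (i, i))"
    by (intro diagonal_mat_eq_mat_diag) (auto simp: SU_def)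
  then show "\<exists>f. mat_diag N f \<in> carrier (SU N) \<and> M = PSU_class N (mat_diag N f)"
    using D by metis
next
  assume "\<exists>f. mat_diag N f \<in> carrier (SU N) \<and> M = PSU_class N (mat_diag N f)"
  then show "M \<in> diag_torus N"
    unfolding diag_torus_def diagonal_mat_def by force
qed

text \<open>
  Both \<open>\<T>\<close> (no condition on the diagonal) and its subgroup defined by constancy on blocks are instances.
  Inverses are covered by conjugation, since the entries are unimodular.
\<close>

lemma subgroup_diag_classes:
  assumes one: "P (\<lambda>_. 1)" and cnj: "\<And>f. P f \<Longrightarrow> P (\<lambda>i. cnj (f i))"
    and mult: "\<And>f g. P f \<Longrightarrow> P g \<Longrightarrow> P (\<lambda>i. f i * g i)"
  shows "subgroup {PSU_class N (mat_diag N f) |f. mat_diag N f \<in> carrier (SU N) \<and> P f} (PSU N)"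
    (is "subgroup ?H _")
proof -
  interpret group_hom "SU N" "PSU N" "PSU_class N" by (rule group_hom_PSU_class)
  have "subgroup {mat_diag N f |f. mat_diag N f \<in> carrier (SU N) \<and> P f} (SU N)"
  proof (rule G.subgroupI)
    have "mat_diag N (\<lambda>_. 1) \<in> carrier (SU N)" by (subst mat_diag_in_SU_iff) auto
    then show "{mat_diag N f |f. mat_diag N f \<in> carrier (SU N) \<and> P f} \<noteq> {}" using one by blast
  next
    fix a assume "a \<in> {mat_diag N f |f. mat_diag N f \<in> carrier (SU N) \<and> P f}"
    then obtain f where f: "a = mat_diag N f" "mat_diag N f \<in> carrier (SU N)" "P f" by auto
    show "inv\<^bsub>SU N\<^esub> a \<in> {mat_diag N f |f. mat_diag N f \<in> carrier (SU N) \<and> P f}"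
      using mat_diag_cnj_in_SU[OF f(2)] cnj[OF f(3)] f(2) by (auto simp: f(1) inv_SU_mat_diag)
  next
    fix a b assume "a \<in> {mat_diag N f |f. mat_diag N f \<in> carrier (SU N) \<and> P f}"
      "b \<in> {mat_diag N f |f. mat_diag N f \<in> carrier (SU N) \<and> P f}"
    then obtain f g where f: "a = mat_diag N f" "mat_diag N f \<in> carrier (SU N)" "P f"
      and g: "b = mat_diag N g" "mat_diag N g \<in> carrier (SU N)" "P g" by auto
    show "a \<otimes>\<^bsub>SU N\<^esub> b \<in> {mat_diag N f |f. mat_diag N f \<in> carrier (SU N) \<and> P f}"
      using mat_diag_mult_in_SU[OF f(2) g(2)] mult[OF f(3) g(3)] by (auto simp: f(1) g(1) mult_SU)
  qed auto
  then have "subgroup (PSU_class N ` {mat_diag N f |f. mat_diag N f \<in> carrier (SU N) \<and> P f}) (PSU N)"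
    by (rule subgroup_img_is_subgroup)
  moreover have "PSU_class N ` {mat_diag N f |f. mat_diag N f \<in> carrier (SU N) \<and> P f} = ?H" by blast
  ultimately show ?thesis by simp
qed

lemma subgroup_diag_torus: "subgroup (diag_torus N) (PSU N)"
proof -
  have "diag_torus N = {PSU_class N (mat_diag N f) |f. mat_diag N f \<in> carrier (SU N) \<and> True}"
    by (auto simp: diag_torus_iff)
  then show ?thesis using subgroup_diag_classes[of "\<lambda>_. True" N] by simp
qed

lemma Hausdorff_space_euclidean_t2:
  "Hausdorff_space (euclidean :: 'a :: t2_space topology)"
  unfolding Hausdorff_space_def disjnt_def by simp (meson hausdorff)

text \<open>
  The ratios map the torus injectively and continuously into a power of the complex plane, which is
  enough to separate points.
\<close>

lemma Hausdorff_diag_torus: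
  "Hausdorff_space (subtopology (PSU_topology N) (diag_torus N))"
proof (rule Hausdorff_space_injective_preimage)
  let ?F = "\<lambda>M. \<lambda>i\<in>{..<N}. diag_ratio i M"
  show "Hausdorff_space (product_topology (\<lambda>_. euclidean :: complex topology) {..<N})"
    by (simp add: Hausdorff_space_product_topology Hausdorff_space_euclidean_t2)
  show "continuous_map (subtopology (PSU_topology N) (diag_torus N))
      (product_topology (\<lambda>_. euclidean) {..<N}) ?F"
    by (auto simp: continuous_map_componentwise intro!: continuous_map_from_subtopology continuous_map_diag_ratio)
  show "inj_on ?F (topspace (subtopology (PSU_topology N) (diag_torus N)))"
  proof (rule inj_onI)
    fix M M' assume "M \<in> topspace (subtopology (PSU_topology N) (diag_torus N))"
      "M' \<in> topspace (subtopology (PSU_topology N) (diag_torus N))" and eq: "?F M = ?F M'"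
    then obtain f g where f: "mat_diag N f \<in> carrier (SU N)" "M = PSU_class N (mat_diag N f)"
      and g: "mat_diag N g \<in> carrier (SU N)" "M' = PSU_class N (mat_diag N g)"
      by (auto simp: diag_torus_iff)
    have "f i * cnj (f 0) = g i * cnj (g 0)" if "i < N" for i
      using fun_cong[OF eq, of i] that f g by (simp add: diag_ratio_mat_diag)
    then show "M = M'" unfolding f g by (intro PSU_class_mat_diag_eqI f g)
  qed
qed


section \<open>Blocks of coordinates\<close>

text \<open>
  The number of the block that contains the coordinate \<open>i\<close>. For \<open>i = 0\<close> the empty sum makes it \<open>0\<close>,
  in agreement with the convention that coordinate \<open>0\<close> is a block of its own.
\<close>

definition block_index :: "(nat \<Rightarrow> nat) \<Rightarrow> nat \<Rightarrow> nat" where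
  "block_index k i = (LEAST j. i \<le> (\<Sum>m=1..j. k m))"

lemma sum_atLeast1_atMost_split:
  fixes k :: "nat \<Rightarrow> nat"
  assumes "1 \<le> j"
  shows "(\<Sum>m=1..j. k m) = (\<Sum>m=1..<j. k m) + k j"
  using assms by (metis atLeastLessThanSuc_atLeastAtMost sum.atLeastLessThan_Suc)

lemma mem_block_iff:
  assumes "1 \<le> j"
  shows "i \<in> block k j \<longleftrightarrow> (\<Sum>m=1..<j. k m) < i \<and> i \<le> (\<Sum>m=1..j. k m)"
proof
  assume "i \<in> block k j"
  then show "(\<Sum>m=1..<j. k m) < i \<and> i \<le> (\<Sum>m=1..j. k m)"
    using assms unfolding sum_atLeast1_atMost_split[OF assms] block_def idx_def by auto
next
  assume "(\<Sum>m=1..<j. k m) < i \<and> i \<le> (\<Sum>m=1..j. k m)"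
  then have "i = idx k j (i - (\<Sum>m=1..<j. k m))" "i - (\<Sum>m=1..<j. k m) \<in> {1..k j}"
    unfolding sum_atLeast1_atMost_split[OF assms] idx_def by auto
  then show "i \<in> block k j" using assms by (auto simp: block_def)
qed

lemma idx_in_block: "1 \<le> j \<Longrightarrow> 1 \<le> r \<Longrightarrow> r \<le> k j \<Longrightarrow> idx k j r \<in> block k j"
  by (auto simp: block_def)

lemma finite_block [simp]: "finite (block k j)"
  by (simp add: block_def)

lemma block_index_eq:
  assumes i: "i \<in> block k j"
  shows "block_index k i = j"
proof (cases "j = 0")
  case True
  then show ?thesis using i by (auto simp: block_def block_index_def intro: Least_equality)
next
  case False
  then have ij: "(\<Sum>m=1..<j. k m) < i" "i \<le> (\<Sum>m=1..j. k m)"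
    using i by (auto simp: mem_block_iff)
  show ?thesis unfolding block_index_def
  proof (rule Least_equality)
    fix y assume y: "i \<le> (\<Sum>m=1..y. k m)"
    show "j \<le> y"
    proof (rule ccontr)
      assume "\<not> j \<le> y"
      then have "(\<Sum>m=1..y. k m) \<le> (\<Sum>m=1..<j. k m)" by (intro sum_mono2) auto
      then show False using y ij by simp
    qed
  qed (rule ij)
qed

lemma block_index_le_and_mem:
  assumes "i \<le> (\<Sum>m=1..l. k m)"
  shows "block_index k i \<le> l" "i \<in> block k (block_index k i)"
proof -
  show "block_index k i \<le> l" unfolding block_index_def using assms by (rule Least_le)
  define j where "j = block_index k i"
  have up: "i \<le> (\<Sum>m=1..j. k m)"
    unfolding j_def block_index_def using assms by (rule LeastI)
  show "i \<in> block k (block_index k i)"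
  proof (cases "j = 0")
    case True
    then show ?thesis using up by (simp add: j_def block_def)
  next
    case False
    then have "j - 1 < block_index k i" by (simp add: j_def)
    then have "\<not> i \<le> (\<Sum>m=1..j-1. k m)" unfolding block_index_def by (rule not_less_Least)
    moreover have "{1..j-1} = {1..<j}" using False by auto
    ultimately have "i \<in> block k j" using up False by (simp add: mem_block_iff)
    then show ?thesis by (simp add: j_def)
  qed
qed

lemma block_index_ge_1:
  assumes "1 \<le> i" "i \<le> (\<Sum>m=1..l. k m)"
  shows "block_index k i \<in> {1..l}"
proof -
  have "block_index k i \<noteq> 0"
  proof
    assume "block_index k i = 0"
    then have "i \<in> block k 0" using block_index_le_and_mem(2)[OF assms(2)] by simp
    then show False using assms(1) by (simp add: block_def)
  qed
  then show ?thesis using block_index_le_and_mem(1)[OF assms(2)] by simp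
qed

lemma block_le:
  assumes i: "i \<in> block k j" and j: "j \<le> l"
  shows "i \<le> (\<Sum>m=1..l. k m)"
proof (cases "j = 0")
  case True
  then show ?thesis using i by (simp add: block_def)
next
  case False
  then have "i \<le> (\<Sum>m=1..j. k m)" using i by (simp add: mem_block_iff)
  also have "\<dots> \<le> (\<Sum>m=1..l. k m)" using j by (intro sum_mono2) auto
  finally show ?thesis .
qed

text \<open>
  The block numbered \<open>j\<close> has \<open>k j\<close> elements; this turns determinants of block scalar matrices into
  the monomials \<open>\<Prod>\<^sub>j t\<^sub>j\<^bsup>k\<^sub>j\<^esup>\<close>.
\<close>

lemma prod_block_index:
  fixes F :: "nat \<Rightarrow> 'a :: comm_monoid_mult"
  shows "(\<Prod>i=1..(\<Sum>j=1..l. k j). F (block_index k i)) = (\<Prod>j=1..l. F j ^ k j)"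
proof (induction l)
  case 0
  then show ?case by simp
next
  case (Suc l)
  define S where "S = (\<Sum>j=1..l. k j)"
  have S': "(\<Sum>j=1..Suc l. k j) = S + k (Suc l)" by (simp add: S_def)
  have split: "{1..S + k (Suc l)} = {1..S} \<union> {S + 1..S + k (Suc l)}" by auto
  have bi: "block_index k i = Suc l" if "i \<in> {S + 1..S + k (Suc l)}" for i
  proof (rule block_index_eq)
    show "i \<in> block k (Suc l)"
      using that by (simp add: mem_block_iff S' atLeastLessThanSuc_atLeastAtMost) (simp add: S_def)
  qed
  have "(\<Prod>i=1..S + k (Suc l). F (block_index k i))
      = (\<Prod>i=1..S. F (block_index k i)) * (\<Prod>i=S+1..S + k (Suc l). F (block_index k i))"
    unfolding split by (rule prod.union_disjoint) auto
  also have "(\<Prod>i=S+1..S + k (Suc l). F (block_index k i)) = (\<Prod>i=S+1..S + k (Suc l). F (Suc l))"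
    using bi by (intro prod.cong) auto
  finally show ?case using Suc.IH by (simp add: S' S_def)
qed

section \<open>The functions in the class are well defined on projective space\<close>

text \<open>
  The multipliers may have different arguments on different blocks, but they must have a common modulus
  \<open>\<rho>\<close>: homogeneity of \<open>a\<close> absorbs only a common factor of the block norms. On block \<open>j\<close> what remains is
  the power \<open>(u * cnj u) ^ d = 1\<close> of the phase \<open>u = c j / \<rho>\<close>, where \<open>d\<close> is the common degree of
  \<open>p\<close> and \<open>q\<close> on that block. Equal multipliers give invariance under a change of
  representative of a point; unimodular ones give invariance under block scalar matrices.
\<close>

lemma formula_value_block_scale:
  assumes part: "(\<Sum>j=1..l. k j) = n"
    and hom: "homogeneous_deg0 (l + 1) a"
    and adm: "admissible_indices n l k h p q"
    and w: "w \<in> carrier_vec (n + 1)" "w \<noteq> 0\<^sub>v (n + 1)"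
    and v: "\<And>i. i \<le> n \<Longrightarrow> v $ i = c (block_index k i) * w $ i"
    and c: "\<And>j. j \<le> l \<Longrightarrow> cmod (c j) = \<rho>" and \<rho>: "0 < \<rho>"
  shows "formula_value l k a p q v = formula_value l k a p q w"
proof -
  have vb: "v $ i = c j * w $ i" if "j \<le> l" "i \<in> block k j" for i j
    using v[of i] block_le[OF that(2,1)] block_index_eq[OF that(2)] part by simp
  have norm: "block_norm k v j = \<rho> * block_norm k w j" if "j \<le> l" for j
  proof -
    have "block_norm k v j = L2_set (\<lambda>i. \<rho> * cmod (w $ i)) (block k j)"
      unfolding block_norm_def using that by (intro L2_set_cong) (auto simp: vb norm_mult c)
    then show ?thesis using \<rho> by (simp add: block_norm_def L2_set_right_distrib)
  qed
  define x where "x = vec (l + 1) (block_norm k w)"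
  have "vec (l + 1) (block_norm k v) = \<rho> \<cdot>\<^sub>v x"
    using norm by (intro eq_vecI) (auto simp: x_def)
  moreover have "a (\<rho> \<cdot>\<^sub>v x) = a x"
  proof -
    obtain i where i: "i \<le> n" "w $ i \<noteq> 0"
      using w by (metis eq_vecI carrier_vecD index_zero_vec less_Suc_eq_le Suc_eq_plus1)
    define j where "j = block_index k i"
    have j: "j \<le> l" "i \<in> block k j"
      unfolding j_def using i part block_index_le_and_mem[of i k l] by auto
    then have "block_norm k w j \<noteq> 0" using i by (auto simp: block_norm_def L2_set_eq_0_iff)
    then have "x $ j \<noteq> 0" using j by (simp add: x_def)
    then have "x \<noteq> 0\<^sub>v (l + 1)" using j by auto
    moreover have "x \<in> carrier_vec (l + 1)" "\<forall>j<l + 1. 0 \<le> x $ j"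
      by (auto simp: x_def block_norm_def L2_set_nonneg)
    ultimately show ?thesis using hom \<rho> unfolding homogeneous_deg0_def by blast
  qed
  moreover have factor: "(\<Prod>i\<in>block k j. (v $ i / of_real (block_norm k v j)) ^ p i) *
        (\<Prod>i\<in>block k j. (cnj (v $ i) / of_real (block_norm k v j)) ^ q i)
      = (\<Prod>i\<in>block k j. (w $ i / of_real (block_norm k w j)) ^ p i) *
        (\<Prod>i\<in>block k j. (cnj (w $ i) / of_real (block_norm k w j)) ^ q i)"
    if j: "j \<in> {0..l}" for j
  proof -
    define u where "u = c j / of_real \<rho>"
    have "cmod u = 1" using c[of j] \<rho> j by (simp add: u_def norm_divide)
    then have u: "cnj u * u = 1" by (simp add: unimodular_iff_mult_cnj)
    have "(\<Prod>i\<in>block k j. (v $ i / of_real (block_norm k v j)) ^ p i)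
        = (\<Prod>i\<in>block k j. u ^ p i * (w $ i / of_real (block_norm k w j)) ^ p i)"
      using j by (intro prod.cong) (auto simp: vb norm u_def simp flip: power_mult_distrib)
    also have "\<dots> = u ^ (\<Sum>i\<in>block k j. p i) * (\<Prod>i\<in>block k j. (w $ i / of_real (block_norm k w j)) ^ p i)"
      by (simp add: prod.distrib power_sum)
    finally have P: "(\<Prod>i\<in>block k j. (v $ i / of_real (block_norm k v j)) ^ p i) = \<dots>" .
    have "(\<Prod>i\<in>block k j. (cnj (v $ i) / of_real (block_norm k v j)) ^ q i)
        = (\<Prod>i\<in>block k j. cnj u ^ q i * (cnj (w $ i) / of_real (block_norm k w j)) ^ q i)"
      using j by (intro prod.cong) (auto simp: vb norm u_def simp flip: power_mult_distrib)
    also have "\<dots> = cnj u ^ (\<Sum>i\<in>block k j. q i) *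
        (\<Prod>i\<in>block k j. (cnj (w $ i) / of_real (block_norm k w j)) ^ q i)"
      by (simp add: prod.distrib power_sum)
    finally have Q: "(\<Prod>i\<in>block k j. (cnj (v $ i) / of_real (block_norm k v j)) ^ q i) = \<dots>" .
    have "(\<Sum>i\<in>block k j. p i) = (\<Sum>i\<in>block k j. q i)"
      using adm j by (auto simp: admissible_indices_def)
    then have "u ^ (\<Sum>i\<in>block k j. p i) * cnj u ^ (\<Sum>i\<in>block k j. q i) = (cnj u * u) ^ (\<Sum>i\<in>block k j. q i)"
      by (simp add: power_mult_distrib mult.commute)
    also have "\<dots> = 1" by (simp add: u)
    finally show ?thesis unfolding P Q by (simp add: mult_ac)
  qed
  ultimately show ?thesis
    unfolding formula_value_def x_def by (simp add: prod.cong[OF refl factor])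
qed

text \<open>
  Every admissible choice of \<open>a\<close>, \<open>p\<close>, \<open>q\<close> does define a function on projective space, so that the
  test functions used below are available.
\<close>

lemma ex_A_kh_member:
  assumes part: "(\<Sum>j=1..l. k j) = n"
    and hom: "homogeneous_deg0 (l + 1) a" and adm: "admissible_indices n l k h p q"
  shows "\<exists>\<phi>\<in>A_kh n l k h. dom \<phi> = proj_point ` formula_dom n l k p q \<and>
     (\<forall>w \<in> formula_dom n l k p q. \<phi> (proj_point w) = Some (formula_value l k a p q w))"
proof -
  let ?D = "formula_dom n l k p q"
  define rep where "rep L = (SOME w. w \<in> ?D \<and> proj_point w = L)" for L
  define \<phi> where "\<phi> L = (if L \<in> proj_point ` ?D then Some (formula_value l k a p q (rep L)) else None)" for L
  have "\<phi> (proj_point w) = Some (formula_value l k a p q w)" if w: "w \<in> ?D" for w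
  proof -
    have "rep (proj_point w) \<in> ?D \<and> proj_point (rep (proj_point w)) = proj_point w"
      unfolding rep_def by (rule someI[of _ w]) (use w in simp)
    moreover have "rep (proj_point w) \<in> proj_point (rep (proj_point w))"
      by (auto simp: proj_point_def intro: exI[of _ 1])
    ultimately obtain c where c: "c \<noteq> 0" "rep (proj_point w) = c \<cdot>\<^sub>v w"
      unfolding proj_point_def by auto
    have wc: "w \<in> carrier_vec (n + 1)" "w \<noteq> 0\<^sub>v (n + 1)" using w by (auto simp: formula_dom_def)
    have "formula_value l k a p q (c \<cdot>\<^sub>v w) = formula_value l k a p q w"
      by (rule formula_value_block_scale[OF part hom adm wc, of _ "\<lambda>_. c" "cmod c"]) (use wc c in auto)
    then show ?thesis using c w by (simp add: \<phi>_def)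
  qed
  moreover have "dom \<phi> = proj_point ` ?D" by (auto simp: \<phi>_def dom_def)
  ultimately show ?thesis
    using hom adm unfolding A_kh_def by blast
qed

lemma formula_value_single_pair:
  assumes j: "j \<le> l" and a: "a \<in> block k j" and b: "b \<in> block k j"
  shows "formula_value l k (\<lambda>_. 1) (\<lambda>i. if i = a then 1 else 0) (\<lambda>i. if i = b then 1 else 0) w
    = (w $ a / of_real (block_norm k w j)) * (cnj (w $ b) / of_real (block_norm k w j))"
proof -
  have delta: "(\<Prod>i\<in>B. g i ^ (if i = e then 1 else 0)) = (if e \<in> B then g e else 1)"
    if "finite B" for B :: "nat set" and g :: "nat \<Rightarrow> complex" and e
  proof -
    have "(\<Prod>i\<in>B. g i ^ (if i = e then 1 else 0)) = (\<Prod>i\<in>B. if i = e then g i else 1)"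
      by (intro prod.cong) auto
    then show ?thesis using that by simp
  qed
  have mem: "a \<in> block k j' \<longleftrightarrow> j' = j" "b \<in> block k j' \<longleftrightarrow> j' = j" for j'
    using a b block_index_eq by metis+
  have "formula_value l k (\<lambda>_. 1) (\<lambda>i. if i = a then 1 else 0) (\<lambda>i. if i = b then 1 else 0) w
    = (\<Prod>j'=0..l. if j' = j then (w $ a / of_real (block_norm k w j')) * (cnj (w $ b) / of_real (block_norm k w j')) else 1)"
    unfolding formula_value_def by (simp only: delta finite_block mem mult_1) (intro prod.cong, auto)
  then show ?thesis using j by simp
qed

section \<open>The elements of the torus preserving the class\<close>

text \<open>
  Constancy on blocks is sufficient by \<open>formula_value_block_scale\<close>. For necessity, the pairs
  \<open>r \<le> h j < s\<close> yield \<open>f (idx k j r) = f (idx k j s)\<close>, and any two positions of a block are linked by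
  such pairs through the last position and, if needed, the first one.
\<close>

lemma T_k_mat_diag_iff:
  assumes k: "is_partition n l k" and h: "\<forall>j\<in>{1..l}. 1 \<le> h j \<and> h j \<le> k j - 1"
    and f: "mat_diag (n + 1) f \<in> carrier (SU (n + 1))"
  shows "PSU_class (n + 1) (mat_diag (n + 1) f) \<in> T_k n l k h \<longleftrightarrow>
    (\<forall>j\<in>{1..l}. \<forall>i\<in>block k j. \<forall>i'\<in>block k j. f i = f i')"
proof -
  let ?M = "PSU_class (n + 1) (mat_diag (n + 1) f)"
  have part: "(\<Sum>j=1..l. k j) = n" and kpos: "\<And>j. j \<in> {1..l} \<Longrightarrow> 0 < k j"
    using k by (auto simp: is_partition_def)
  have f1: "cmod (f i) = 1" if "i \<le> n" for i using f that by (auto simp: mat_diag_in_SU_iff)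
  have act: "PSU_act ?M (proj_point w) = proj_point (vec (n + 1) (\<lambda>i. f i * w $ i))"
    if "w \<in> carrier_vec (n + 1)" for w
    using PSU_act_class[OF f that] mat_diag_mult_vec[OF that] by simp
  have torus: "?M \<in> diag_torus (n + 1)" using f by (auto simp: diag_torus_iff)
  show ?thesis
  proof
    assume M: "?M \<in> T_k n l k h"
    have pair: "f (idx k j r) = f (idx k j s)"
      if j: "j \<in> {1..l}" and r: "1 \<le> r" "r \<le> h j" and s: "h j < s" "s \<le> k j" for j r s
    proof -
      define a b where "a = idx k j r" and "b = idx k j s"
      define p q :: "nat \<Rightarrow> nat" where "p = (\<lambda>i. if i = a then 1 else 0)" and "q = (\<lambda>i. if i = b then 1 else 0)"
      have ab: "a \<in> block k j" "b \<in> block k j" "a \<noteq> b"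
        using j r s by (auto simp: a_def b_def idx_def block_def)
      have le: "a \<le> n" "b \<le> n" using block_le[of _ k j l] ab part j by auto
      have mem: "a \<in> block k j' \<longleftrightarrow> j' = j" "b \<in> block k j' \<longleftrightarrow> j' = j" for j'
        using ab block_index_eq by metis+
      have "(\<Sum>i=0..n. p i * q i) = 0" using ab by (auto simp: p_def q_def)
      moreover have "(\<Sum>i\<in>block k j'. p i) = (\<Sum>i\<in>block k j'. q i)" for j'
        by (simp add: p_def q_def mem)
      moreover have "p (idx k j' r') = 0" if "j' \<in> {1..l}" "h j' < r'" "r' \<le> k j'" for j' r'
      proof -
        have "idx k j' r' \<in> block k j'" using that by (intro idx_in_block) auto
        moreover have "idx k j r' \<noteq> a" if "h j < r'" using that r by (auto simp: a_def idx_def)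
        ultimately show ?thesis using mem that by (auto simp: p_def)
      qed
      moreover have "q (idx k j' s') = 0" if "j' \<in> {1..l}" "1 \<le> s'" "s' \<le> h j'" for j' s'
      proof -
        have "h j' \<le> k j'" using h that by (meson diff_le_self le_trans)
        then have "idx k j' s' \<in> block k j'" using that by (intro idx_in_block) auto
        moreover have "idx k j s' \<noteq> b" if "s' \<le> h j" using that s by (auto simp: b_def idx_def)
        ultimately show ?thesis using mem that by (auto simp: q_def)
      qed
      ultimately have adm: "admissible_indices n l k h p q" by (simp add: admissible_indices_def)
      have hom: "homogeneous_deg0 (l + 1) (\<lambda>_. 1)" by (simp add: homogeneous_deg0_def)
      obtain \<phi> where \<phi>: "\<phi> \<in> A_kh n l k h" "dom \<phi> = proj_point ` formula_dom n l k p q"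
        and val: "\<forall>w \<in> formula_dom n l k p q. \<phi> (proj_point w) = Some (formula_value l k (\<lambda>_. 1) p q w)"
        using ex_A_kh_member[OF part hom adm] by (elim bexE conjE) (rule that)
      \<comment> \<open>The point with all coordinates \<open>1\<close> avoids every exceptional set, and so does its image.\<close>
      define e v where "e = vec (n + 1) (\<lambda>_. 1 :: complex)" and "v = vec (n + 1) f"
      have dom: "w \<in> formula_dom n l k p q" if w: "w \<in> carrier_vec (n + 1)" "\<And>i. i \<le> n \<Longrightarrow> w $ i \<noteq> 0" for w
      proof -
        have "w \<noteq> 0\<^sub>v (n + 1)" using w(2)[of 0] by auto
        moreover have "\<exists>i\<in>block k j'. w $ i \<noteq> 0" if "j' \<le> l" "i \<in> block k j'" for j' i
          using that w(2) block_le[OF that(2,1)] part by blast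
        ultimately show ?thesis using w(1) unfolding formula_dom_def by auto
      qed
      have e: "e \<in> formula_dom n l k p q" by (rule dom) (auto simp: e_def)
      have v: "v \<in> formula_dom n l k p q"
        by (rule dom) (use f1 in \<open>fastforce simp: v_def\<close>)+
      have "proj_point e \<in> dom \<phi>" unfolding \<phi>(2) using e by (rule imageI)
      then have "\<phi> (PSU_act ?M (proj_point e)) = \<phi> (proj_point e)"
        using M \<phi>(1) unfolding T_k_def by simp
      moreover have "PSU_act ?M (proj_point e) = proj_point v"
      proof -
        have "vec (n + 1) (\<lambda>i. f i * e $ i) = v" by (intro eq_vecI) (auto simp: e_def v_def)
        then show ?thesis using act[of e] by (simp add: e_def)
      qed
      ultimately have eq: "formula_value l k (\<lambda>_. 1) p q v = formula_value l k (\<lambda>_. 1) p q e"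
        using val e v by simp
      define B where "B = block_norm k e j"
      have ble: "i \<le> n" if "i \<in> block k j" for i using block_le[OF that, of l] part j by auto
      have "block_norm k v j = B"
        unfolding B_def block_norm_def using ble f1 by (intro L2_set_cong) (auto simp: e_def v_def less_Suc_eq_le)
      moreover have "B \<noteq> 0"
        using ab(1) le by (auto simp: B_def block_norm_def L2_set_eq_0_iff e_def intro!: bexI[of _ a])
      ultimately have "f a * cnj (f b) = 1"
        using eq formula_value_single_pair[of j l a k b, OF _ ab(1,2)] le j
        unfolding p_def q_def by (simp add: e_def[symmetric] B_def[symmetric]) (simp add: e_def v_def)
      then have "f a * (cnj (f b) * f b) = f b" by (simp flip: mult.assoc)
      moreover have "cnj (f b) * f b = 1" using f1[OF le(2)] unfolding unimodular_iff_mult_cnj .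
      ultimately show ?thesis unfolding a_def b_def by simp
    qed
    have "f i = f (idx k j (k j))" if j: "j \<in> {1..l}" and i: "i \<in> block k j" for i j
    proof -
      obtain r where r: "i = idx k j r" "1 \<le> r" "r \<le> k j" using i j by (auto simp: block_def)
      have hj: "1 \<le> h j" "h j < k j" using h j kpos by fastforce+
      show ?thesis
      proof (cases "r \<le> h j")
        case True
        then show ?thesis using pair[OF j] r hj by simp
      next
        case False
        then have "f i = f (idx k j 1)" using pair[OF j, of 1 r] r hj by simp
        also have "\<dots> = f (idx k j (k j))" using pair[OF j, of 1 "k j"] hj by simp
        finally show ?thesis .
      qed
    qed
    then show "\<forall>j\<in>{1..l}. \<forall>i\<in>block k j. \<forall>i'\<in>block k j. f i = f i'" by metis
  next
    assume const: "\<forall>j\<in>{1..l}. \<forall>i\<in>block k j. \<forall>i'\<in>block k j. f i = f i'"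
    define c where "c j = f (if j = 0 then 0 else idx k j 1)" for j
    have rep: "(if j = 0 then 0 else idx k j 1) \<in> block k j" if "j \<le> l" for j
      using that kpos[of j] by (auto simp: block_def)
    have c1: "cmod (c j) = 1" if "j \<le> l" for j
      unfolding c_def using block_le[OF rep[OF that] that] part by (intro f1) simp
    have fc: "f i = c (block_index k i)" if "i \<le> n" for i
    proof -
      define j where "j = block_index k i"
      have j: "j \<le> l" "i \<in> block k j"
        unfolding j_def using that part block_index_le_and_mem[of i k l] by auto
      show ?thesis
      proof (cases "j = 0")
        case True
        then show ?thesis using j unfolding j_def[symmetric] by (simp add: c_def block_def)
      next
        case False
        then have j1: "j \<in> {1..l}" using j(1) by simp
        show ?thesis
          unfolding c_def j_def[symmetric] using bspec[OF bspec[OF bspec[OF const j1] j(2)] rep[OF j(1)]] .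
      qed
    qed
    show "?M \<in> T_k n l k h"
      unfolding T_k_def
    proof (intro CollectI conjI torus ballI)
      fix \<phi> L assume \<phi>: "\<phi> \<in> A_kh n l k h" and L: "L \<in> dom \<phi>"
      from \<phi> obtain a p q where hom: "homogeneous_deg0 (l + 1) a" and adm: "admissible_indices n l k h p q"
        and dom: "dom \<phi> = proj_point ` formula_dom n l k p q"
        and val: "\<forall>w \<in> formula_dom n l k p q. \<phi> (proj_point w) = Some (formula_value l k a p q w)"
        unfolding A_kh_def mem_Collect_eq by (elim exE conjE) (rule that)
      obtain w where w: "w \<in> formula_dom n l k p q" "L = proj_point w" using L dom by blast
      then have wc: "w \<in> carrier_vec (n + 1)" "w \<noteq> 0\<^sub>v (n + 1)" by (auto simp: formula_dom_def)
      define v where "v = vec (n + 1) (\<lambda>i. f i * w $ i)"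
      have vi: "v $ i = 0 \<longleftrightarrow> w $ i = 0" if "i \<le> n" for i
        using that f1[OF that] by (auto simp: v_def)
      have "v \<in> formula_dom n l k p q"
      proof -
        obtain i where i: "i \<le> n" "w $ i \<noteq> 0"
          using wc by (metis eq_vecI carrier_vecD index_zero_vec less_Suc_eq_le Suc_eq_plus1)
        then have "v \<noteq> 0\<^sub>v (n + 1)" using vi[of i] by auto
        moreover have "\<exists>i\<in>block k j. v $ i \<noteq> 0" if "j \<le> l" "i \<in> block k j" "w $ i \<noteq> 0" for i j
          using that vi block_le[OF that(2,1)] part by blast
        ultimately show ?thesis using w(1) unfolding formula_dom_def by (fastforce simp: v_def)
      qed
      then have "\<phi> (proj_point v) = Some (formula_value l k a p q v)" using val by blast
      also have "formula_value l k a p q v = formula_value l k a p q w"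
        by (rule formula_value_block_scale[OF part hom adm wc, of _ c 1]) (auto simp: v_def fc c1)
      finally show "\<phi> (PSU_act ?M L) = \<phi> L" using val w act[OF wc(1)] by (simp add: v_def)
    qed
  qed
qed


section \<open>Block scalar matrices\<close>

text \<open>
  The diagonal of \<open>block_scalar_mat\<close>. Its entry at \<open>0\<close> is the one that makes the determinant equal
  to \<open>1\<close>.
\<close>

definition block_scalar_entry :: "nat \<Rightarrow> (nat \<Rightarrow> nat) \<Rightarrow> (nat \<Rightarrow> complex) \<Rightarrow> nat \<Rightarrow> complex" where
  "block_scalar_entry l k t i = (if i = 0 then \<Prod>j=1..l. cnj (t j) ^ k j else t (block_index k i))"

lemma block_scalar_entry_block:
  assumes "1 \<le> j" "i \<in> block k j"
  shows "block_scalar_entry l k t i = t j"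
  using assms block_index_eq[OF assms(2)] by (auto simp: block_scalar_entry_def mem_block_iff)

lemma diag_block_mat_scalar_blocks:
  "diag_block_mat (z \<cdot>\<^sub>m 1\<^sub>m 1 # map (\<lambda>j. t j \<cdot>\<^sub>m 1\<^sub>m (k j)) [1..<l + 1])
    = mat_diag ((\<Sum>j=1..l. k j) + 1) (\<lambda>i. if i = 0 then z else (t (block_index k i) :: complex))"
proof (induction l)
  case 0
  show ?case by (intro eq_matI) auto
next
  case (Suc l)
  define S where "S = (\<Sum>j=1..l. k j)"
  define e where "e = (\<lambda>i. if i = 0 then z else t (block_index k i))"
  have S': "(\<Sum>j=1..Suc l. k j) = S + k (Suc l)" by (simp add: S_def)
  have e_new: "e i = t (Suc l)" if "S < i" "i \<le> S + k (Suc l)" for i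
  proof -
    have "i \<in> block k (Suc l)"
      using that by (simp add: mem_block_iff S' atLeastLessThanSuc_atLeastAtMost) (simp add: S_def)
    then show ?thesis using block_index_eq[of i k "Suc l"] that by (simp add: e_def)
  qed
  have "z \<cdot>\<^sub>m 1\<^sub>m 1 # map (\<lambda>j. t j \<cdot>\<^sub>m 1\<^sub>m (k j)) [1..<Suc l + 1]
    = (z \<cdot>\<^sub>m 1\<^sub>m 1 # map (\<lambda>j. t j \<cdot>\<^sub>m 1\<^sub>m (k j)) [1..<l + 1]) @ [t (Suc l) \<cdot>\<^sub>m 1\<^sub>m (k (Suc l))]"
    by simp
  then have "diag_block_mat (z \<cdot>\<^sub>m 1\<^sub>m 1 # map (\<lambda>j. t j \<cdot>\<^sub>m 1\<^sub>m (k j)) [1..<Suc l + 1])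
    = four_block_mat (mat_diag (S + 1) e) (0\<^sub>m (S + 1) (k (Suc l))) (0\<^sub>m (k (Suc l)) (S + 1))
        (t (Suc l) \<cdot>\<^sub>m 1\<^sub>m (k (Suc l)))"
    by (simp only: diag_block_mat_last Let_def Suc.IH S_def[symmetric] e_def[symmetric]) simp
  also have "\<dots> = mat_diag (S + k (Suc l) + 1) e"
  proof (rule eq_matI)
    fix i j assume "i < dim_row (mat_diag (S + k (Suc l) + 1) e)" "j < dim_col (mat_diag (S + k (Suc l) + 1) e)"
    then have ij: "i < S + k (Suc l) + 1" "j < S + k (Suc l) + 1" by auto
    then show "four_block_mat (mat_diag (S + 1) e) (0\<^sub>m (S + 1) (k (Suc l))) (0\<^sub>m (k (Suc l)) (S + 1))
        (t (Suc l) \<cdot>\<^sub>m 1\<^sub>m (k (Suc l))) $$ (i, j) = mat_diag (S + k (Suc l) + 1) e $$ (i, j)"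
      using e_new[of i] e_new[of j] by auto
  qed auto
  finally show ?case unfolding S' e_def .
qed

lemma block_scalar_mat_eq_mat_diag:
  assumes "(\<Sum>j=1..l. k j) = n"
  shows "block_scalar_mat l k t = mat_diag (n + 1) (block_scalar_entry l k t)"
  unfolding block_scalar_mat_def diag_block_mat_scalar_blocks assms
  by (simp add: mat_diag_eq_iff block_scalar_entry_def)

lemma prod_block_scalar:
  fixes f :: "nat \<Rightarrow> complex"
  assumes part: "(\<Sum>j=1..l. k j) = n"
    and f: "\<And>i. 1 \<le> i \<Longrightarrow> i \<le> n \<Longrightarrow> f i = t (block_index k i)"
  shows "(\<Prod>i<n + 1. f i) = f 0 * (\<Prod>j=1..l. t j ^ k j)"
proof -
  have "{..<n + 1} = insert 0 {1..n}" by auto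
  then have "(\<Prod>i<n + 1. f i) = f 0 * (\<Prod>i=1..n. f i)" by simp
  also have "(\<Prod>i=1..n. f i) = (\<Prod>i=1..n. t (block_index k i))" using f by (intro prod.cong) auto
  also have "\<dots> = (\<Prod>j=1..l. t j ^ k j)" using prod_block_index[of t k l] unfolding part .
  finally show ?thesis .
qed

lemma prod_cnj_power_inverse:
  assumes "\<forall>j\<in>{1..l}. t j \<in> sphere 0 1"
  shows "(\<Prod>j=1..l. cnj (t j) ^ k j) * (\<Prod>j=1..l. t j ^ k j) = 1"
  unfolding prod.distrib[symmetric] using assms
  by (intro prod.neutral) (auto simp: unimodular_iff_mult_cnj simp flip: power_mult_distrib)

lemma block_scalar_mat_in_SU:
  assumes part: "(\<Sum>j=1..l. k j) = n" and t: "\<forall>j\<in>{1..l}. t j \<in> sphere 0 1"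
  shows "mat_diag (n + 1) (block_scalar_entry l k t) \<in> carrier (SU (n + 1))"
  unfolding mat_diag_in_SU_iff
proof (intro conjI allI impI)
  have "(\<Prod>i<n + 1. block_scalar_entry l k t i) = block_scalar_entry l k t 0 * (\<Prod>j=1..l. t j ^ k j)"
    by (rule prod_block_scalar[OF part]) (simp add: block_scalar_entry_def)
  then show "(\<Prod>i<n + 1. block_scalar_entry l k t i) = 1"
    using prod_cnj_power_inverse[OF t] by (simp add: block_scalar_entry_def)
next
  fix i assume i: "i < n + 1"
  show "cmod (block_scalar_entry l k t i) = 1"
  proof (cases "i = 0")
    case True
    then show ?thesis
      using t by (auto simp: block_scalar_entry_def norm_power simp flip: prod_norm intro!: prod.neutral)
  next
    case False
    have "block_index k i \<in> {1..l}" using block_index_ge_1[of i k l] False i part by simp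
    then show ?thesis using False t by (auto simp: block_scalar_entry_def)
  qed
qed

text \<open>
  Given \<open>f\<close> constant on blocks, \<open>t\<close> is read off at the first position of each block; then \<open>f 0\<close> has to
  be the remaining entry, since both have the same product with \<open>\<Prod>\<^sub>j t\<^sub>j\<^bsup>k\<^sub>j\<^esup>\<close>.
\<close>

lemma T_k_iff_block_scalar:
  assumes k: "is_partition n l k" and h: "\<forall>j\<in>{1..l}. 1 \<le> h j \<and> h j \<le> k j - 1"
  shows "M \<in> T_k n l k h \<longleftrightarrow>
    (\<exists>t. (\<forall>j\<in>{1..l}. t j \<in> sphere 0 1) \<and> M = PSU_class (n + 1) (block_scalar_mat l k t))"
proof
  have part: "(\<Sum>j=1..l. k j) = n" and kpos: "\<And>j. j \<in> {1..l} \<Longrightarrow> 0 < k j"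
    using k by (auto simp: is_partition_def)
  show "M \<in> T_k n l k h"
    if "\<exists>t. (\<forall>j\<in>{1..l}. t j \<in> sphere 0 1) \<and> M = PSU_class (n + 1) (block_scalar_mat l k t)"
  proof -
    from that obtain t where t: "\<forall>j\<in>{1..l}. t j \<in> sphere 0 1"
      and M: "M = PSU_class (n + 1) (block_scalar_mat l k t)" by blast
    show ?thesis
      unfolding M block_scalar_mat_eq_mat_diag[OF part] T_k_mat_diag_iff[OF k h block_scalar_mat_in_SU[OF part t]]
      by (auto simp: block_scalar_entry_block)
  qed
  show "\<exists>t. (\<forall>j\<in>{1..l}. t j \<in> sphere 0 1) \<and> M = PSU_class (n + 1) (block_scalar_mat l k t)"
    if M: "M \<in> T_k n l k h"
  proof -
    from M have "M \<in> diag_torus (n + 1)" by (simp add: T_k_def)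
    then obtain f where f: "mat_diag (n + 1) f \<in> carrier (SU (n + 1))"
      and Mf: "M = PSU_class (n + 1) (mat_diag (n + 1) f)" by (auto simp: diag_torus_iff)
    have const: "\<forall>j\<in>{1..l}. \<forall>i\<in>block k j. \<forall>i'\<in>block k j. f i = f i'"
      using M unfolding Mf T_k_mat_diag_iff[OF k h f] .
    define t where "t j = f (idx k j 1)" for j
    have rep: "idx k j 1 \<in> block k j" if "j \<in> {1..l}" for j
      using that kpos[OF that] by (intro idx_in_block) auto
    have t: "\<forall>j\<in>{1..l}. t j \<in> sphere 0 1"
    proof
      fix j assume j: "j \<in> {1..l}"
      then have "idx k j 1 \<le> n" using block_le[OF rep[OF j], of l] part by simp
      then show "t j \<in> sphere 0 1" using f unfolding t_def mat_diag_in_SU_iff by simp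
    qed
    have ft: "f i = t (block_index k i)" if "1 \<le> i" "i \<le> n" for i
    proof -
      have j: "block_index k i \<le> l" "i \<in> block k (block_index k i)"
        using block_index_le_and_mem[of i k l] that part by auto
      have j1: "block_index k i \<in> {1..l}" using block_index_ge_1[of i k l] that part by simp
      show ?thesis unfolding t_def using bspec[OF bspec[OF bspec[OF const j1] j(2)] rep[OF j1]] .
    qed
    have "f 0 * (\<Prod>j=1..l. t j ^ k j) = 1"
      using prod_block_scalar[OF part, of f t] ft f by (simp add: mat_diag_in_SU_iff)
    moreover have "block_scalar_entry l k t 0 * (\<Prod>j=1..l. t j ^ k j) = 1"
      using prod_cnj_power_inverse[OF t] by (simp add: block_scalar_entry_def)
    ultimately have "f 0 = block_scalar_entry l k t 0"
      by (metis mult_right_cancel mult_zero_right zero_neq_one)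
    then have "f i = block_scalar_entry l k t i" if "i < n + 1" for i
      using ft[of i] that by (cases "i = 0") (auto simp: block_scalar_entry_def)
    then have "mat_diag (n + 1) f = block_scalar_mat l k t"
      by (simp add: block_scalar_mat_eq_mat_diag[OF part] mat_diag_eq_iff)
    then show ?thesis using t Mf by auto
  qed
qed

section \<open>The isomorphism with the torus\<close>

lemma cis_Arg_unimodular:
  assumes "cmod u = 1"
  shows "cis (Arg u) = u"
proof -
  have "sgn u = u" using assms by (simp add: sgn_eq)
  then show ?thesis using assms by (metis cis_Arg norm_zero zero_neq_one)
qed

lemma compact_unit_circle: "compact (sphere (0 :: complex) 1)"
proof -
  have "sphere (0 :: complex) 1 = cis ` {-pi..pi}"
  proof (intro equalityI subsetI)
    fix u :: complex assume "u \<in> sphere 0 1"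
    then have "u = cis (Arg u)" by (simp add: cis_Arg_unimodular)
    moreover have "Arg u \<in> {-pi..pi}" using Arg_bounded[of u] by simp
    ultimately show "u \<in> cis ` {-pi..pi}" by (rule image_eqI)
  qed auto
  moreover have "continuous_on {-pi..pi} cis"
    by (intro continuous_intros)
  ultimately show ?thesis using compact_continuous_image[of "{-pi..pi}" cis] by simp
qed

lemma ex_unimodular_root:
  assumes "cmod u = 1" "0 < N"
  shows "\<exists>z. cmod z = 1 \<and> z ^ N = u"
proof (intro exI conjI)
  have "cis (Arg u / real N) ^ N = cis (real N * (Arg u / real N))" by (rule DeMoivre)
  also have "\<dots> = cis (Arg u)" using assms by simp
  also have "\<dots> = u" using assms by (simp add: cis_Arg_unimodular)
  finally show "cis (Arg u / real N) ^ N = u" .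
qed simp

text \<open>
  The quotients \<open>t\<^sub>j / t\<^sub>0\<close>, the coordinates in which \<open>T_k\<close> is a torus. The restriction to \<open>{1..l}\<close> makes
  the result an element of the product group.
\<close>

definition ratio_map :: "nat \<Rightarrow> (nat \<Rightarrow> nat) \<Rightarrow> complex mat set \<Rightarrow> nat \<Rightarrow> complex" where
  "ratio_map l k M = (\<lambda>j\<in>{1..l}. diag_ratio (idx k j 1) M)"

lemma ratio_map_block_scalar:
  assumes k: "is_partition n l k" and t: "\<forall>j\<in>{1..l}. t j \<in> sphere 0 1"
  shows "ratio_map l k (PSU_class (n + 1) (block_scalar_mat l k t))
    = (\<lambda>j\<in>{1..l}. t j * cnj (block_scalar_entry l k t 0))"
proof (unfold ratio_map_def, intro restrict_ext)
  fix j assume j: "j \<in> {1..l}"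
  have part: "(\<Sum>j=1..l. k j) = n" and "0 < k j"
    using k j by (auto simp: is_partition_def)
  then have i: "idx k j 1 \<in> block k j" using j by (intro idx_in_block) auto
  then have "idx k j 1 < n + 1" using block_le[OF i, of l] j part by simp
  then show "diag_ratio (idx k j 1) (PSU_class (n + 1) (block_scalar_mat l k t))
      = t j * cnj (block_scalar_entry l k t 0)"
    using block_scalar_mat_in_SU[OF part t] block_scalar_entry_block[OF _ i, of l t] j
    by (simp only: block_scalar_mat_eq_mat_diag[OF part] diag_ratio_mat_diag) simp
qed

lemma continuous_map_ratio_map:
  assumes k: "is_partition n l k"
  shows "continuous_map (PSU_topology (n + 1)) (product_topology (\<lambda>_. euclidean) {1..l}) (ratio_map l k)"
  unfolding continuous_map_componentwise ratio_map_def
proof (intro conjI ballI)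
  fix j assume j: "j \<in> {1..l}"
  have part: "(\<Sum>j=1..l. k j) = n" and "0 < k j"
    using k j by (auto simp: is_partition_def)
  then have i: "idx k j 1 \<in> block k j" using j by (intro idx_in_block) auto
  then have "idx k j 1 < n + 1" using block_le[OF i, of l] j part by simp
  then show "continuous_map (PSU_topology (n + 1)) euclidean
      (\<lambda>M. (\<lambda>j\<in>{1..l}. diag_ratio (idx k j 1) M) j)"
    using continuous_map_diag_ratio j by simp
qed auto

lemma ratio_map_mult:
  assumes k: "is_partition n l k"
    and M: "M \<in> diag_torus (n + 1)" and M': "M' \<in> diag_torus (n + 1)"
  shows "ratio_map l k (M \<otimes>\<^bsub>PSU (n + 1)\<^esub> M') = (\<lambda>j\<in>{1..l}. ratio_map l k M j * ratio_map l k M' j)"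
proof -
  obtain f g where f: "mat_diag (n + 1) f \<in> carrier (SU (n + 1))" "M = PSU_class (n + 1) (mat_diag (n + 1) f)"
    and g: "mat_diag (n + 1) g \<in> carrier (SU (n + 1))" "M' = PSU_class (n + 1) (mat_diag (n + 1) g)"
    using M M' by (auto simp: diag_torus_iff)
  have MM': "M \<otimes>\<^bsub>PSU (n + 1)\<^esub> M' = PSU_class (n + 1) (mat_diag (n + 1) (\<lambda>i. f i * g i))"
    using group_hom.hom_mult[OF group_hom_PSU_class f(1) g(1)] by (simp add: f(2) g(2) mult_SU)
  show ?thesis
    unfolding ratio_map_def
  proof (intro restrict_ext)
    fix j assume j: "j \<in> {1..l}"
    have part: "(\<Sum>j=1..l. k j) = n" and "0 < k j"
      using k j by (auto simp: is_partition_def)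
    then have i: "idx k j 1 \<in> block k j" using j by (intro idx_in_block) auto
    then have "idx k j 1 < n + 1" using block_le[OF i, of l] j part by simp
    then show "diag_ratio (idx k j 1) (M \<otimes>\<^bsub>PSU (n + 1)\<^esub> M')
      = (\<lambda>j\<in>{1..l}. diag_ratio (idx k j 1) M) j * (\<lambda>j\<in>{1..l}. diag_ratio (idx k j 1) M') j"
      using j diag_ratio_mat_diag[OF mat_diag_mult_in_SU[OF f(1) g(1)]]
        diag_ratio_mat_diag[OF f(1)] diag_ratio_mat_diag[OF g(1)]
      unfolding MM' by (simp add: f(2) g(2))
  qed
qed

text \<open>
  Injectivity holds because on block scalar matrices these \<open>l\<close> ratios determine all \<open>n + 1\<close> of
  them. For surjectivity, \<open>t\<^sub>j = z s\<^sub>j\<close> has the required ratios provided that its corner entry is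
  \<open>z\<close>, that is, \<open>z\<^bsup>n+1\<^esup> = \<Prod>\<^sub>j cnj (s\<^sub>j)\<^bsup>k\<^sub>j\<^esup>\<close>.
\<close>

lemma bij_betw_ratio_map:
  assumes k: "is_partition n l k" and h: "\<forall>j\<in>{1..l}. 1 \<le> h j \<and> h j \<le> k j - 1"
  shows "bij_betw (ratio_map l k) (T_k n l k h) (\<Pi>\<^sub>E j\<in>{1..l}. sphere 0 1)"
proof -
  have part: "(\<Sum>j=1..l. k j) = n" using k by (simp add: is_partition_def)
  have t0: "cmod (block_scalar_entry l k t 0) = 1" if "\<forall>j\<in>{1..l}. t j \<in> sphere 0 1" for t
    using block_scalar_mat_in_SU[OF part that] by (simp add: mat_diag_in_SU_iff)
  show ?thesis
    unfolding bij_betw_def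
  proof (intro conjI)
    show "inj_on (ratio_map l k) (T_k n l k h)"
    proof (rule inj_onI)
      fix M M' assume "M \<in> T_k n l k h" "M' \<in> T_k n l k h" and eq: "ratio_map l k M = ratio_map l k M'"
      then obtain t t' where t: "\<forall>j\<in>{1..l}. t j \<in> sphere 0 1" "M = PSU_class (n + 1) (block_scalar_mat l k t)"
        and t': "\<forall>j\<in>{1..l}. t' j \<in> sphere 0 1" "M' = PSU_class (n + 1) (block_scalar_mat l k t')"
        unfolding T_k_iff_block_scalar[OF k h] by blast
      let ?f = "block_scalar_entry l k t" and ?g = "block_scalar_entry l k t'"
      have "?f i * cnj (?f 0) = ?g i * cnj (?g 0)" if "i < n + 1" for i
      proof (cases "i = 0")
        case True
        then show ?thesis using t0[OF t(1)] t0[OF t'(1)]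
          by (simp add: unimodular_iff_mult_cnj mult.commute)
      next
        case False
        have j1: "block_index k i \<in> {1..l}" using block_index_ge_1[of i k l] that False part by simp
        have "t j * cnj (?f 0) = t' j * cnj (?g 0)" if "j \<in> {1..l}" for j
          using fun_cong[OF eq, of j] that
          unfolding t(2) t'(2) ratio_map_block_scalar[OF k t(1)] ratio_map_block_scalar[OF k t'(1)] by simp
        from this[OF j1] show ?thesis using False by (simp add: block_scalar_entry_def)
      qed
      then show "M = M'"
        unfolding t(2) t'(2) block_scalar_mat_eq_mat_diag[OF part]
        by (intro PSU_class_mat_diag_eqI block_scalar_mat_in_SU part t(1) t'(1))
    qed
  next
    show "ratio_map l k ` T_k n l k h = (\<Pi>\<^sub>E j\<in>{1..l}. sphere 0 1)"
    proof (intro equalityI subsetI)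
      fix s assume "s \<in> ratio_map l k ` T_k n l k h"
      then obtain M where M: "M \<in> T_k n l k h" and s: "s = ratio_map l k M" by blast
      from M obtain t where t: "\<forall>j\<in>{1..l}. t j \<in> sphere 0 1"
        and Mt: "M = PSU_class (n + 1) (block_scalar_mat l k t)"
        unfolding T_k_iff_block_scalar[OF k h] by blast
      show "s \<in> (\<Pi>\<^sub>E j\<in>{1..l}. sphere 0 1)"
        unfolding s Mt ratio_map_block_scalar[OF k t] using t t0[OF t] by (auto simp: norm_mult)
    next
      fix s :: "nat \<Rightarrow> complex" assume s: "s \<in> (\<Pi>\<^sub>E j\<in>{1..l}. sphere 0 1)"
      then have s1: "\<forall>j\<in>{1..l}. s j \<in> sphere 0 1" by auto
      have "cmod (\<Prod>j=1..l. cnj (s j) ^ k j) = 1"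
        using s1 by (auto simp: norm_power simp flip: prod_norm intro!: prod.neutral)
      then obtain z where z: "cmod z = 1" "z ^ (n + 1) = (\<Prod>j=1..l. cnj (s j) ^ k j)"
        using ex_unimodular_root[of _ "n + 1"] by auto
      define t where "t j = z * s j" for j
      have t: "\<forall>j\<in>{1..l}. t j \<in> sphere 0 1" using s1 z by (auto simp: t_def norm_mult)
      have "block_scalar_entry l k t 0 = (\<Prod>j=1..l. cnj z ^ k j) * (\<Prod>j=1..l. cnj (s j) ^ k j)"
        by (simp add: block_scalar_entry_def t_def power_mult_distrib prod.distrib)
      also have "(\<Prod>j=1..l. cnj z ^ k j) = cnj z ^ n" unfolding power_sum[symmetric] part ..
      also have "cnj z ^ n * (\<Prod>j=1..l. cnj (s j) ^ k j) = (cnj z * z) ^ n * z"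
        unfolding z(2)[symmetric] by (simp add: power_mult_distrib)
      also have "\<dots> = z" using z(1) by (simp add: unimodular_iff_mult_cnj)
      finally have t00: "block_scalar_entry l k t 0 = z" .
      have "t j * cnj z = s j" for j
      proof -
        have "t j * cnj z = (cnj z * z) * s j" by (simp add: t_def)
        also have "\<dots> = s j" using z(1) by (simp add: unimodular_iff_mult_cnj)
        finally show ?thesis .
      qed
      then have "s = ratio_map l k (PSU_class (n + 1) (block_scalar_mat l k t))"
        unfolding ratio_map_block_scalar[OF k t] t00 using s
        by (auto simp: fun_eq_iff restrict_def PiE_def extensional_def)
      moreover have "PSU_class (n + 1) (block_scalar_mat l k t) \<in> T_k n l k h"
        unfolding T_k_iff_block_scalar[OF k h] using t by blast
      ultimately show "s \<in> ratio_map l k ` T_k n l k h" by blast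
    qed
  qed
qed

text \<open>
  The parametrization by \<open>t\<close> is continuous into the matrices, hence into the quotient. It is not
  injective, which is irrelevant for compactness of the image.
\<close>

lemma compactin_T_k:
  assumes k: "is_partition n l k" and h: "\<forall>j\<in>{1..l}. 1 \<le> h j \<and> h j \<le> k j - 1"
  shows "compactin (PSU_topology (n + 1)) (T_k n l k h)"
proof -
  let ?g = "\<lambda>t. mat_diag (n + 1) (block_scalar_entry l k t)"
  have part: "(\<Sum>j=1..l. k j) = n" using k by (simp add: is_partition_def)
  have top: "topspace (torus_topology l) = (\<Pi>\<^sub>E j\<in>{1..l}. sphere 0 1)"
    by (simp add: torus_topology_def)
  have proj: "continuous_map (torus_topology l) euclidean (\<lambda>t. t j)" if "j \<in> {1..l}" for j
    using continuous_map_product_projection[OF that, of "\<lambda>_. top_of_set (sphere (0::complex) 1)"]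
    by (auto simp: torus_topology_def continuous_map_in_subtopology)
  have entry: "continuous_map (torus_topology l) euclidean (\<lambda>t. block_scalar_entry l k t i)"
    if "i < n + 1" for i
  proof (cases "i = 0")
    case True
    have "continuous_map (torus_topology l) euclidean ((\<lambda>z. cnj z ^ k j) \<circ> (\<lambda>t. t j))" if "j \<in> {1..l}" for j
      by (rule continuous_map_compose[OF proj[OF that]]) (simp add: continuous_intros)
    then have "continuous_map (torus_topology l) euclidean (\<lambda>t. \<Prod>j=1..l. cnj (t j) ^ k j)"
      by (intro continuous_map_prod_complex) (simp add: o_def)
    then show ?thesis using True by (simp add: block_scalar_entry_def)
  next
    case False
    have "block_index k i \<in> {1..l}" using block_index_ge_1[of i k l] that False part by simp
    then show ?thesis using proj False by (simp add: block_scalar_entry_def)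
  qed
  have "continuous_map (torus_topology l) (SU_topology (n + 1)) ?g"
    unfolding SU_topology_def
  proof (rule continuous_map_pullback')
    show "topspace (torus_topology l) \<subseteq> ?g -` carrier (SU (n + 1))"
      unfolding top using block_scalar_mat_in_SU[OF part] by blast
    show "continuous_map (torus_topology l) (product_topology (\<lambda>_. euclidean) ({..<n + 1} \<times> {..<n + 1}))
      ((\<lambda>A. \<lambda>ij\<in>{..<n + 1} \<times> {..<n + 1}. A $$ ij) \<circ> ?g)"
      unfolding continuous_map_componentwise o_def
    proof (intro conjI ballI)
      fix ij assume "ij \<in> {..<n + 1} \<times> {..<n + 1}"
      then obtain i j where ij: "ij = (i, j)" "i < n + 1" "j < n + 1" by blast
      have "(\<lambda>t. (\<lambda>ij\<in>{..<n + 1} \<times> {..<n + 1}. ?g t $$ ij) ij)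
          = (\<lambda>t. if i = j then block_scalar_entry l k t j else 0)"
        using ij by auto
      then show "continuous_map (torus_topology l) euclidean
          (\<lambda>t. (\<lambda>ij\<in>{..<n + 1} \<times> {..<n + 1}. ?g t $$ ij) ij)"
        using entry[OF ij(3)] by (cases "i = j") simp_all
    qed auto
  qed
  then have "continuous_map (torus_topology l) (PSU_topology (n + 1)) (PSU_class (n + 1) \<circ> ?g)"
    by (rule continuous_map_compose) (rule quotient_imp_continuous_map[OF quotient_map_PSU_class])
  moreover have "compact_space (torus_topology l)"
    unfolding torus_topology_def compact_space_product_topology
    by (simp add: compact_space_subtopology compact_unit_circle)
  then have "compactin (torus_topology l) (topspace (torus_topology l))"
    unfolding compact_space_def .
  ultimately have "compactin (PSU_topology (n + 1))
      ((PSU_class (n + 1) \<circ> ?g) ` (\<Pi>\<^sub>E j\<in>{1..l}. sphere 0 1))"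
    unfolding top[symmetric] by (intro image_compactin)
  also have "(PSU_class (n + 1) \<circ> ?g) ` (\<Pi>\<^sub>E j\<in>{1..l}. sphere 0 1) = T_k n l k h"
  proof (intro equalityI subsetI)
    fix M assume "M \<in> (PSU_class (n + 1) \<circ> ?g) ` (\<Pi>\<^sub>E j\<in>{1..l}. sphere 0 1)"
    then show "M \<in> T_k n l k h"
      unfolding T_k_iff_block_scalar[OF k h] block_scalar_mat_eq_mat_diag[OF part] by force
  next
    fix M assume "M \<in> T_k n l k h"
    then obtain t where t: "\<forall>j\<in>{1..l}. t j \<in> sphere 0 1"
      and M: "M = PSU_class (n + 1) (block_scalar_mat l k t)"
      unfolding T_k_iff_block_scalar[OF k h] by blast
    \<comment> \<open>Points of the product space are \<open>undefined\<close> outside \<open>{1..l}\<close>, so \<open>t\<close> has to be restricted.\<close>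
    have "block_scalar_entry l k t i = block_scalar_entry l k (restrict t {1..l}) i" if "i < n + 1" for i
    proof (cases "i = 0")
      case True
      then show ?thesis by (simp add: block_scalar_entry_def)
    next
      case False
      then have "block_index k i \<in> {1..l}" using block_index_ge_1[of i k l] that part by simp
      then show ?thesis using False by (simp add: block_scalar_entry_def)
    qed
    then have "?g t = ?g (restrict t {1..l})" unfolding mat_diag_eq_iff by blast
    then have "M = (PSU_class (n + 1) \<circ> ?g) (restrict t {1..l})"
      using M by (simp add: block_scalar_mat_eq_mat_diag[OF part])
    moreover have "restrict t {1..l} \<in> (\<Pi>\<^sub>E j\<in>{1..l}. sphere 0 1)" using t by auto
    ultimately show "M \<in> (PSU_class (n + 1) \<circ> ?g) ` (\<Pi>\<^sub>E j\<in>{1..l}. sphere 0 1)" by (rule image_eqI)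
  qed
  finally show ?thesis .
qed

lemma subgroup_T_k:
  assumes k: "is_partition n l k" and h: "\<forall>j\<in>{1..l}. 1 \<le> h j \<and> h j \<le> k j - 1"
  shows "subgroup (T_k n l k h) (PSU (n + 1))"
proof -
  define P :: "(nat \<Rightarrow> complex) \<Rightarrow> bool"
    where "P f \<longleftrightarrow> (\<forall>j\<in>{1..l}. \<forall>i\<in>block k j. \<forall>i'\<in>block k j. f i = f i')" for f
  have "M \<in> T_k n l k h \<longleftrightarrow>
      (\<exists>f. M = PSU_class (n + 1) (mat_diag (n + 1) f) \<and> mat_diag (n + 1) f \<in> carrier (SU (n + 1)) \<and> P f)" for M
  proof
    assume M: "M \<in> T_k n l k h"
    then have "M \<in> diag_torus (n + 1)" by (simp add: T_k_def)
    then obtain f where "mat_diag (n + 1) f \<in> carrier (SU (n + 1))" "M = PSU_class (n + 1) (mat_diag (n + 1) f)"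
      by (auto simp: diag_torus_iff)
    moreover from M have "P f"
      unfolding calculation(2) T_k_mat_diag_iff[OF k h calculation(1)] P_def .
    ultimately show "\<exists>f. M = PSU_class (n + 1) (mat_diag (n + 1) f) \<and> mat_diag (n + 1) f \<in> carrier (SU (n + 1)) \<and> P f"
      by blast
  next
    assume "\<exists>f. M = PSU_class (n + 1) (mat_diag (n + 1) f) \<and> mat_diag (n + 1) f \<in> carrier (SU (n + 1)) \<and> P f"
    then obtain f where f: "M = PSU_class (n + 1) (mat_diag (n + 1) f)"
      "mat_diag (n + 1) f \<in> carrier (SU (n + 1))" "P f" by (elim exE conjE)
    show "M \<in> T_k n l k h" using f(3) unfolding f(1) T_k_mat_diag_iff[OF k h f(2)] P_def .
  qed
  then have "T_k n l k h =
      {PSU_class (n + 1) (mat_diag (n + 1) f) |f. mat_diag (n + 1) f \<in> carrier (SU (n + 1)) \<and> P f}"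
    by blast
  also have "subgroup \<dots> (PSU (n + 1))"
  proof (rule subgroup_diag_classes)
    show "P (\<lambda>i. f i * g i)" if "P f" "P g" for f g using that unfolding P_def by metis
    show "P (\<lambda>i. cnj (f i))" if "P f" for f using that unfolding P_def by metis
  qed (simp add: P_def)
  finally show ?thesis .
qed

theorem theorem5p2:
  fixes n l :: nat and k h :: "nat \<Rightarrow> nat"
  assumes "is_partition n l k"
    and "\<forall>j\<in>{1..l}. 1 \<le> h j \<and> h j \<le> k j - 1"
  shows "subgroup (T_k n l k h) (PSU (n + 1)\<lparr>carrier := diag_torus (n + 1)\<rparr>) \<and>
    closedin (subtopology (PSU_topology (n + 1)) (diag_torus (n + 1))) (T_k n l k h) \<and>
    (\<exists>f \<in> iso (PSU (n + 1)\<lparr>carrier := T_k n l k h\<rparr>) (torus_group l).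
       homeomorphic_map (subtopology (PSU_topology (n + 1)) (T_k n l k h)) (torus_topology l) f) \<and>
    (\<forall>M. M \<in> T_k n l k h \<longleftrightarrow>
       (\<exists>t. (\<forall>j\<in>{1..l}. t j \<in> sphere 0 1) \<and> M = PSU_class (n + 1) (block_scalar_mat l k t)))"
proof (intro conjI allI)
  let ?T = "T_k n l k h" and ?X = "PSU_topology (n + 1)"
  have sub: "?T \<subseteq> diag_torus (n + 1)" by (auto simp: T_k_def)
  have groupPSU: "group (PSU (n + 1))"
    using group_hom_PSU_class by (simp add: group_hom_def)
  show "subgroup ?T (PSU (n + 1)\<lparr>carrier := diag_torus (n + 1)\<rparr>)"
    by (rule group.subgroup_incl[OF groupPSU subgroup_T_k[OF assms] subgroup_diag_torus sub])
  show "closedin (subtopology ?X (diag_torus (n + 1))) ?T"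
    using compactin_T_k[OF assms] sub
    by (intro compactin_imp_closedin Hausdorff_diag_torus) (simp add: compactin_subtopology)
  have PSU_sub: "?T \<subseteq> carrier (PSU (n + 1))"
    using subgroup.subset[OF subgroup_T_k[OF assms]] .
  have bij: "bij_betw (ratio_map l k) ?T (\<Pi>\<^sub>E j\<in>{1..l}. sphere 0 1)"
    by (rule bij_betw_ratio_map[OF assms])
  have torus_carrier: "carrier (torus_group l) = (\<Pi>\<^sub>E j\<in>{1..l}. sphere 0 1)"
    by (simp add: torus_group_def circle_group_def)
  show "\<exists>f \<in> iso (PSU (n + 1)\<lparr>carrier := ?T\<rparr>) (torus_group l).
       homeomorphic_map (subtopology ?X ?T) (torus_topology l) f"
  proof (rule bexI)
    have "ratio_map l k (x \<otimes>\<^bsub>PSU (n + 1)\<^esub> y) = ratio_map l k x \<otimes>\<^bsub>torus_group l\<^esub> ratio_map l k y"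
      if "x \<in> ?T" "y \<in> ?T" for x y
      using ratio_map_mult[OF assms(1)] that sub by (auto simp: torus_group_def circle_group_def)
    then show "ratio_map l k \<in> iso (PSU (n + 1)\<lparr>carrier := ?T\<rparr>) (torus_group l)"
      using bij bij_betw_imp_surj_on[OF bij] by (auto simp: iso_def hom_def torus_carrier)
    show "homeomorphic_map (subtopology ?X ?T) (torus_topology l) (ratio_map l k)"
    proof (rule continuous_imp_homeomorphic_map)
      have top: "topspace (subtopology ?X ?T) = ?T" using PSU_sub by auto
      have "torus_topology l
          = subtopology (product_topology (\<lambda>_. euclidean) {1..l}) (\<Pi>\<^sub>E j\<in>{1..l}. sphere 0 1)"
        by (simp add: torus_topology_def subtopology_product_topology)
      then show "continuous_map (subtopology ?X ?T) (torus_topology l) (ratio_map l k)"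
        using continuous_map_ratio_map[OF assms(1)] bij_betw_imp_surj_on[OF bij]
        by (auto simp: continuous_map_in_subtopology top intro: continuous_map_from_subtopology)
      show "compact_space (subtopology ?X ?T)"
        using compactin_T_k[OF assms] by (simp add: compact_space_subtopology)
      show "Hausdorff_space (torus_topology l)"
        by (auto simp: torus_topology_def Hausdorff_space_product_topology
            intro: Hausdorff_space_subtopology Hausdorff_space_euclidean_t2)
      show "ratio_map l k ` topspace (subtopology ?X ?T) = topspace (torus_topology l)"
        using bij_betw_imp_surj_on[OF bij] unfolding top by (simp add: torus_topology_def)
      show "inj_on (ratio_map l k) (topspace (subtopology ?X ?T))"
        using bij_betw_imp_inj_on[OF bij] unfolding top .
    qed
  qed
  show "M \<in> ?T \<longleftrightarrow>
       (\<exists>t. (\<forall>j\<in>{1..l}. t j \<in> sphere 0 1) \<and> M = PSU_class (n + 1) (block_scalar_mat l k t))" for M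
    by (rule T_k_iff_block_scalar[OF assms])
qed

end
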